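(* The space of all polynomial moulds $A\in ARI^{pol}$ that are alternal and push-invariant and that satisfy a family of corrected Fay relations of the form $$\mathcal{F}(A')(u_1,\ldots,u_r)=k_r\,(u_2+\cdots+u_r)\qquad (r\ge 2)$$ for some set of constants $(k_r)_{r\ge 2}$ is isomorphic (as a vector space) to the elliptic Kashiwara–Vergne Lie algebra $\mathfrak{krv}_{ell}$.
   Context: A mould over $\mathbb{Q}$ is a family $A=(A_r)_{r\ge0}$ where $A_r$ is a rational function over $\mathbb{Q}$ in $r$ commutative variables $u_1,\ldots,u_r$ ($A_0=A(\emptyset)$ is a constant); we write $A(u_1,\ldots,u_r)$ for $A_r$, the depth $r$ part. Moulds are added and multiplied by scalars depth by depth. $ARI$ is the vector space of moulds with $A(\emptyset)=0$; $ARI^{pol}$ is the subspace of those with polynomial components. For a mould $A$ and $r\ge1$: $A'(u_1,\ldots,u_r)=\frac{A(u_1,\ldots,u_r)}{u_1\cdots u_r}$ and $\Delta A(u_1,\ldots,u_r)=u_1\cdots u_r(u_1+\cdots+u_r)A(u_1,\ldots,u_r)$ (both operators leave $A(\emptyset)$ unchanged). $A$ is alternal if $A\bigl(sh((u_1,\ldots,u_i),(u_{i+1},\ldots,u_r))\bigr)=0$ for $r\ge2$, $1\le i\le r-1$, where $A(sh(\cdot,\cdot))$ denotes the sum of the values of $A$ over all shuffles of the two sequences. $A$ is push-invariant if $A(-u_1-\cdots-u_r,u_1,\ldots,u_{r-1})=A(u_1,\ldots,u_r)$ for all $r\ge1$. The Fay operator is $$\mathcal{F}(B)(u_1,\ldots,u_r)=B(u_1,\ldots,u_r)+B(u_2,\ldots,u_r,-\bar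 u_r)+\sum_{i=1}^{r-1}B(u_2,\ldots,u_i,-\bar u_i,\bar u_{i+1},u_{i+2},\ldots,u_r),\quad \bar u_i=u_1+\cdots+u_i.$$ The swap of $A$ is $swapA(v_1,\ldots,v_r)=A(v_r,v_{r-1}-v_r,\ldots,v_1-v_2)$. A mould $B$ in variables $v_i$ is circ-neutral if for every $r\ge2$, $B(v_1,\ldots,v_r)+B(v_2,\ldots,v_r,v_1)+\cdots+B(v_r,v_1,\ldots,v_{r-1})=0$. A constant mould is a mould $C=(c_r)_r$ whose value in each depth $r$ is a constant $c_r$. Let $c_i=ad(a)^{i-1}(b)$, $i\ge1$, in $\mathbb{Q}\langle\langle a,b\rangle\rangle$. Power series in the free variables $c_i$ form the kernel of the derivation $a\mapsto1$, $b\mapsto0$; on them $ma$ is the linear map sending a monomial $c_{a_1}\cdots c_{a_r}$ to $u_1^{a_1-1}\cdots u_r^{a_r-1}$ (in depth $r$). The mould associated to such a power series $f$ is $ma(f)$. Definition: the underlying vector space of $\mathfrak{krv}_{ell}$ is the space of power series $f\in\mathbb{Q}\langle\langle a,b\rangle\rangle$ (in the kernel above) whose associated mould $F=ma(f)\in ARI^{pol}$ is such that $M:=\Delta^{-1}(F)$ is alternal and push-invariant, and there exists a constant mould $C$ such that $swapM+C$ is circ-neutral. *)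

theory Defs
  imports
    Complex_Main
    "HOL-Library.Poly_Mapping"
    "HOL-Library.Function_Algebras"
    "HOL-Computational_Algebra.Fraction_Field"
begin

section \<open>Rational functions over the rationals\<close>

text \<open>
  Polynomials over the rationals in countably many commuting variables are finitely supported maps
  from exponent vectors to coefficients; rational functions are their fractions. The variables
  \<open>u\<^sub>1, u\<^sub>2, \<dots>\<close> are numbered from 1, and the index 0 is never used.
\<close>

type_synonym mpoly = "(nat \<Rightarrow>\<^sub>0 nat) \<Rightarrow>\<^sub>0 rat"
type_synonym ratfun = "mpoly fract"

definition of_mpoly :: "mpoly \<Rightarrow> ratfun" where
  "of_mpoly p = Fract p 1"

definition rat_const :: "rat \<Rightarrow> ratfun" where
  "rat_const c = of_mpoly (Poly_Mapping.single 0 c)"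

definition var_u :: "nat \<Rightarrow> ratfun" where
  "var_u i = of_mpoly (Poly_Mapping.single (Poly_Mapping.single i 1) 1)"

definition mpolys :: "nat \<Rightarrow> mpoly set" where
  "mpolys r = {p. \<forall>m \<in> Poly_Mapping.keys p. Poly_Mapping.keys m \<subseteq> {1..r}}"

definition ratfuns :: "nat \<Rightarrow> ratfun set" where
  "ratfuns r = {Fract p q | p q. p \<in> mpolys r \<and> q \<in> mpolys r \<and> q \<noteq> 0}"

definition mpoly_eval :: "(nat \<Rightarrow> ratfun) \<Rightarrow> mpoly \<Rightarrow> ratfun" where
  "mpoly_eval \<sigma> p =
     (\<Sum>m \<in> Poly_Mapping.keys p. rat_const (Poly_Mapping.lookup p m) *
        (\<Prod>i \<in> Poly_Mapping.keys m. \<sigma> i ^ Poly_Mapping.lookup m i))"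

text \<open>
  Substitution into a rational function uses any representing fraction whose denominator does
  not vanish under the substitution; the value does not depend on the choice. Such a fraction
  exists for all the (invertible linear) substitutions considered below.
\<close>

definition ratfun_subst :: "(nat \<Rightarrow> ratfun) \<Rightarrow> ratfun \<Rightarrow> ratfun" where
  "ratfun_subst \<sigma> R =
     (THE y. \<exists>p q. q \<noteq> 0 \<and> R = Fract p q \<and> mpoly_eval \<sigma> q \<noteq> 0 \<and>
        y = mpoly_eval \<sigma> p / mpoly_eval \<sigma> q)"


section \<open>Moulds\<close>

text \<open>
  \<open>A r\<close> is the depth \<open>r\<close> part \<open>A(u\<^sub>1,\<dots>,u\<^sub>r)\<close>. Addition of moulds is the pointwise addition of
  functions.
\<close>

type_synonym mould = "nat \<Rightarrow> ratfun"

definition moulds :: "mould set" where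
  "moulds = {A. \<forall>r. A r \<in> ratfuns r}"

definition mould_scale :: "rat \<Rightarrow> mould \<Rightarrow> mould" where
  "mould_scale c A = (\<lambda>r. rat_const c * A r)"

definition ARI :: "mould set" where
  "ARI = {A \<in> moulds. A 0 = 0}"

definition ARI_pol :: "mould set" where
  "ARI_pol = {A \<in> ARI. \<forall>r. A r \<in> of_mpoly ` mpolys r}"

text \<open>The value \<open>A(x\<^sub>1,\<dots>,x\<^sub>r)\<close>, where \<open>r\<close> is the length of the list of arguments.\<close>

definition mould_at :: "mould \<Rightarrow> ratfun list \<Rightarrow> ratfun" where
  "mould_at A xs =
     ratfun_subst (\<lambda>i. if 1 \<le> i \<and> i \<le> length xs then xs ! (i - 1) else 0) (A (length xs))"

definition ubar :: "nat \<Rightarrow> ratfun" where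
  "ubar i = (\<Sum>j = 1..i. var_u j)"

definition mprime :: "mould \<Rightarrow> mould" where
  "mprime A r = (if r = 0 then A 0 else A r / (\<Prod>i = 1..r. var_u i))"

definition mDelta :: "mould \<Rightarrow> mould" where
  "mDelta A r = (if r = 0 then A 0 else (\<Prod>i = 1..r. var_u i) * ubar r * A r)"

text \<open>
  The variables are pairwise distinct, so the set \<open>shuffles\<close> lists every shuffle exactly once.
\<close>

definition alternal :: "mould \<Rightarrow> bool" where
  "alternal A \<longleftrightarrow>
     (\<forall>r \<ge> 2. \<forall>i \<in> {1..r - 1}.
        (\<Sum>w \<in> shuffles [1..<i + 1] [i + 1..<r + 1]. mould_at A (map var_u w)) = 0)"

definition push_invariant :: "mould \<Rightarrow> bool" where
  "push_invariant A \<longleftrightarrow> (\<forall>r \<ge> 1. mould_at A (- ubar r # map var_u [1..<r]) = A r)"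

text \<open>The Fay operator is only meaningful (and only used) in depths \<open>r \<ge> 1\<close>.\<close>

definition fay :: "mould \<Rightarrow> nat \<Rightarrow> ratfun" where
  "fay B r =
     B r + mould_at B (map var_u [2..<r + 1] @ [- ubar r]) +
     (\<Sum>i = 1..r - 1.
        mould_at B (map var_u [2..<i + 1] @ [- ubar i, ubar (i + 1)] @ map var_u [i + 2..<r + 1]))"

text \<open>The variables \<open>v\<^sub>i\<close> of swapped moulds are represented by the same symbols as the \<open>u\<^sub>i\<close>.\<close>

definition mould_swap :: "mould \<Rightarrow> mould" where
  "mould_swap A r =
     (if r = 0 then A 0
      else mould_at A (var_u r # map (\<lambda>i. var_u i - var_u (i + 1)) (rev [1..<r])))"

definition circ_neutral :: "mould \<Rightarrow> bool" where
  "circ_neutral B \<longleftrightarrow>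
     (\<forall>r \<ge> 2. (\<Sum>k < r. mould_at B (rotate k (map var_u [1..<r + 1]))) = 0)"

definition constant_mould :: "mould \<Rightarrow> bool" where
  "constant_mould C \<longleftrightarrow> (\<forall>r. \<exists>c. C r = rat_const c)"


section \<open>Noncommutative power series\<close>

text \<open>A power series in the noncommuting letters \<open>a, b\<close> is its family of coefficients.\<close>

datatype letter = LetterA | LetterB

type_synonym ncps = "letter list \<Rightarrow> rat"

definition nc_scale :: "rat \<Rightarrow> ncps \<Rightarrow> ncps" where
  "nc_scale c f = (\<lambda>w. c * f w)"

definition nc_one :: ncps where
  "nc_one w = (if w = [] then 1 else 0)"

definition nc_letter :: "letter \<Rightarrow> ncps" where
  "nc_letter x w = (if w = [x] then 1 else 0)"

definition nc_mult :: "ncps \<Rightarrow> ncps \<Rightarrow> ncps" where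
  "nc_mult f g w = (\<Sum>i \<le> length w. f (take i w) * g (drop i w))"

definition nc_ad :: "ncps \<Rightarrow> ncps \<Rightarrow> ncps" where
  "nc_ad f g = nc_mult f g - nc_mult g f"

text \<open>
  The continuous derivation \<open>a \<mapsto> 1\<close>, \<open>b \<mapsto> 0\<close> sends a word to the sum of the words obtained by
  deleting one occurrence of \<open>a\<close>. Hence the coefficient of \<open>w\<close> in the image of \<open>f\<close> is the sum of
  the coefficients in \<open>f\<close> of the words obtained by inserting \<open>a\<close> at each of the positions in \<open>w\<close>.
\<close>

definition nc_deriv :: "ncps \<Rightarrow> ncps" where
  "nc_deriv f w = (\<Sum>i \<le> length w. f (take i w @ LetterA # drop i w))"

definition nc_kernel :: "ncps set" where
  "nc_kernel = {f. nc_deriv f = 0}"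

definition c_gen :: "nat \<Rightarrow> ncps" where
  "c_gen i = (nc_ad (nc_letter LetterA) ^^ (i - 1)) (nc_letter LetterB)"

text \<open>
  Monomials in the \<open>c\<^sub>i\<close> are indexed by the exponents of their images under \<open>ma\<close>: the list
  \<open>[e\<^sub>1,\<dots>,e\<^sub>r]\<close> stands for \<open>c\<close> with indices \<open>a\<^sub>j = e\<^sub>j + 1\<close>, which \<open>ma\<close> sends to
  \<open>u\<^sub>1^e\<^sub>1 \<cdots> u\<^sub>r^e\<^sub>r\<close>.
\<close>

definition c_monomial :: "nat list \<Rightarrow> ncps" where
  "c_monomial es = foldr (\<lambda>e g. nc_mult (c_gen (e + 1)) g) es nc_one"

text \<open>
  The power series with coefficients \<open>\<gamma>\<close> in the \<open>c\<^sub>i\<close>. As \<open>c\<^sub>i\<close> is homogeneous of degree \<open>i\<close>, only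
  the finitely many monomials of degree \<open>length w\<close> contribute to the coefficient of \<open>w\<close>.
\<close>

definition c_series :: "(nat list \<Rightarrow> rat) \<Rightarrow> ncps" where
  "c_series \<gamma> w =
     (\<Sum>es | sum_list (map Suc es) = length w. \<gamma> es * c_monomial es w)"

text \<open>
  The depth \<open>r\<close> part of \<open>ma f\<close> is in general a power series in \<open>u\<^sub>1,\<dots>,u\<^sub>r\<close>, given here by the
  coefficients of its monomials. The \<open>c\<^sub>i\<close> are free generators, that is, \<open>c_series\<close> is injective,
  and its range is \<open>nc_kernel\<close>.
\<close>

definition ma :: "ncps \<Rightarrow> nat \<Rightarrow> (nat \<Rightarrow>\<^sub>0 nat) \<Rightarrow> rat" where
  "ma f r m =
     (if Poly_Mapping.keys m \<subseteq> {1..r}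
      then inv c_series f (map (Poly_Mapping.lookup m) [1..<r + 1]) else 0)"

definition ma_is_mould :: "ncps \<Rightarrow> mould \<Rightarrow> bool" where
  "ma_is_mould f F \<longleftrightarrow> (\<forall>r. \<exists>p. F r = of_mpoly p \<and> Poly_Mapping.lookup p = ma f r)"


section \<open>The two spaces\<close>

definition krv_ell :: "ncps set" where
  "krv_ell =
     {f \<in> nc_kernel. \<exists>F \<in> ARI_pol. ma_is_mould f F \<and>
        (let M = inv mDelta F in
           alternal M \<and> push_invariant M \<and>
           (\<exists>C. constant_mould C \<and> circ_neutral (mould_swap M + C)))}"

definition fay_space :: "mould set" where
  "fay_space =
     {A \<in> ARI_pol. alternal A \<and> push_invariant A \<and>
        (\<exists>k :: nat \<Rightarrow> rat. \<forall>r \<ge> 2. fay (mprime A) r = rat_const (k r) * (\<Sum>i = 2..r. var_u i))}"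

definition isomorphic_subspaces ::
  "('k::field \<Rightarrow> 'v::ab_group_add \<Rightarrow> 'v) \<Rightarrow> 'v set \<Rightarrow>
   ('k \<Rightarrow> 'w::ab_group_add \<Rightarrow> 'w) \<Rightarrow> 'w set \<Rightarrow> bool" where
  "isomorphic_subspaces s V t W \<longleftrightarrow>
     vector_space s \<and> vector_space t \<and> module.subspace s V \<and> module.subspace t W \<and>
     (\<exists>\<phi>. bij_betw \<phi> V W \<and>
        (\<forall>x \<in> V. \<forall>y \<in> V. \<phi> (x + y) = \<phi> x + \<phi> y) \<and>
        (\<forall>c. \<forall>x \<in> V. \<phi> (s c x) = t c (\<phi> x)))"


lemma of_mpoly_eq_0_iff: "of_mpoly p = 0 \<longleftrightarrow> p = 0"
  by (simp add: of_mpoly_def Zero_fract_def eq_fract)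

lemma of_mpoly_add: "of_mpoly (p + q) = of_mpoly p + of_mpoly q"
  by (simp add: of_mpoly_def)

lemma of_mpoly_mult: "of_mpoly (p * q) = of_mpoly p * of_mpoly q"
  by (simp add: of_mpoly_def)

lemma var_u_nonzero: "var_u i \<noteq> 0"
proof -
  have "Poly_Mapping.lookup (Poly_Mapping.single (Poly_Mapping.single i (1::nat)) (1::rat))
          (Poly_Mapping.single i 1) \<noteq> 0"
    by (simp only: lookup_single_eq)
  then show ?thesis
    unfolding var_u_def of_mpoly_eq_0_iff by (metis lookup_zero)
qed

lemma ubar_nonzero:
  assumes "r \<ge> 1"
  shows "ubar r \<noteq> 0"
proof -
  let ?X = "\<lambda>j. Poly_Mapping.single (Poly_Mapping.single j (1::nat)) (1::rat)"
  have eq: "(\<Sum>j\<in>J. var_u j) = of_mpoly (\<Sum>j\<in>J. ?X j)" if "finite J" for J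
    using that
    by induction (simp_all add: of_mpoly_add var_u_def, simp add: of_mpoly_def Zero_fract_def)
  have inj: "Poly_Mapping.single j (1::nat) = Poly_Mapping.single 1 1 \<longleftrightarrow> j = 1" for j :: nat
    by (metis lookup_single_eq lookup_single_not_eq zero_neq_one)
  have "Poly_Mapping.lookup (\<Sum>j = 1..r. ?X j) (Poly_Mapping.single 1 1) =
        (\<Sum>j = 1..r. if j = 1 then 1 else 0)"
    unfolding lookup_sum by (intro sum.cong) (auto simp: lookup_single when_def inj[simplified])
  also have "\<dots> \<noteq> 0" using assms by simp
  finally have "(\<Sum>j = 1..r. ?X j) \<noteq> 0" by (metis lookup_zero)
  then show ?thesis by (simp add: ubar_def eq of_mpoly_eq_0_iff)
qed

lemma bij_mDelta: "bij mDelta"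
proof (rule o_bij)
  let ?D = "\<lambda>A r. if r = 0 then A 0 else A r / ((\<Prod>i = 1..r. var_u i) * ubar r) :: ratfun"
  have nz: "(\<Prod>i = 1..r. var_u i) * ubar r \<noteq> 0" if "r \<noteq> 0" for r
    using that ubar_nonzero[of r] var_u_nonzero by simp
  show "?D \<circ> mDelta = id" "mDelta \<circ> ?D = id"
    using nz by (auto simp: fun_eq_iff mDelta_def)
qed

lemma vector_space_mould: "vector_space mould_scale"
proof
  have c_add: "rat_const (a + b) = rat_const a + rat_const b" for a b
    by (simp add: rat_const_def single_add of_mpoly_add)
  have c_mult: "rat_const (a * b) = rat_const a * rat_const b" for a b
    by (simp add: rat_const_def mult_single flip: of_mpoly_mult)
  have c_one: "rat_const 1 = 1"
    by (simp add: rat_const_def of_mpoly_def One_fract_def)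
  fix a b :: rat and x y :: mould
  show "mould_scale a (x + y) = mould_scale a x + mould_scale a y"
    by (simp add: mould_scale_def fun_eq_iff algebra_simps)
  show "mould_scale (a + b) x = mould_scale a x + mould_scale b x"
    by (simp add: mould_scale_def fun_eq_iff c_add algebra_simps)
  show "mould_scale a (mould_scale b x) = mould_scale (a * b) x"
    by (simp add: mould_scale_def fun_eq_iff c_mult algebra_simps)
  show "mould_scale 1 x = x"
    by (simp add: mould_scale_def c_one)
qed

lemma vector_space_ncps: "vector_space nc_scale"
  by unfold_locales (simp_all add: nc_scale_def fun_eq_iff algebra_simps)

end

theory Submission
  imports Defs "HOL-Library.Multiset" "HOL-Library.List_Lexorder"
begin

text \<open>
  The isomorphism sends \<open>A\<close> to the power series \<open>f\<close> with \<open>ma(f) = A\<close>. Put \<open>M = \<Delta>\<^sup>-\<^sup>1 A\<close>. The factor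
  \<open>u\<^sub>1\<cdots>u\<^sub>r(u\<^sub>1 + \<cdots> + u\<^sub>r)\<close> is invariant under permutations and under the push, so \<open>M\<close> is alternal or
  push-invariant iff \<open>A\<close> is. Let \<open>K(x\<^sub>0,\<dots>,x\<^sub>r) = M(x\<^sub>1 - x\<^sub>0, x\<^sub>2 - x\<^sub>1, \<dots>)\<close>; this is translation invariant,
  and push-invariance of \<open>M\<close> means that \<open>K\<close> is invariant under rotation of the \<open>r + 1\<close> points.
  Both remaining conditions then concern the insertion of \<open>0\<close> into a cyclic word of \<open>r\<close> points: the
  circular sum of \<open>swap M\<close> is the sum of \<open>K(0, w)\<close> over the rotations \<open>w\<close> of \<open>(u\<^sub>r,\<dots>,u\<^sub>1)\<close>, and
  \<open>\<F>(A')\<close> is \<open>u\<^sub>2 + \<cdots> + u\<^sub>r\<close> times the sum of \<open>K(0, w)\<close> over the rotations of the partial sums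
  \<open>u\<^sub>1 + \<cdots> + u\<^sub>i\<close>. An invertible linear substitution exchanges the two.

  That the \<open>c\<^sub>i\<close> freely generate the kernel of the derivation comes from restricting coefficients to
  the words ending in \<open>b\<close>. An element of the kernel is determined by them, and on these words the
  monomials in the \<open>c\<^sub>i\<close> are unitriangular for the lexicographic order.
\<close>

section \<open>Substitution into polynomials\<close>

abbreviation mconst :: "rat \<Rightarrow> mpoly" where "mconst c \<equiv> Poly_Mapping.single 0 c"

definition mvar :: "nat \<Rightarrow> mpoly" where
  "mvar i = Poly_Mapping.single (Poly_Mapping.single i 1) 1"

definition mvars :: "nat \<Rightarrow> mpoly list" where
  "mvars r = map mvar [1..<r + 1]"

lemma length_mvars [simp]: "length (mvars r) = r"
  by (simp add: mvars_def)

lemma mvars_Suc: "mvars (Suc r) = mvars r @ [mvar (Suc r)]"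
  by (simp add: mvars_def)

lemma mvars_0 [simp]: "mvars 0 = []"
  by (simp add: mvars_def)

lemma nth_mvars [simp]: "i < r \<Longrightarrow> mvars r ! i = mvar (Suc i)"
  by (simp add: mvars_def del: upt_Suc)

lemma mvar_eq_iff [simp]: "mvar i = mvar j \<longleftrightarrow> i = j"
  unfolding mvar_def by (metis lookup_single_eq lookup_single_not_eq zero_neq_one)

lemma mvar_neq_0 [simp]: "mvar i \<noteq> 0" "0 \<noteq> mvar i"
  unfolding mvar_def by (metis lookup_single_eq lookup_zero zero_neq_one)+

lemma poly_mapping_sum_monomials:
  "p = (\<Sum>m\<in>Poly_Mapping.keys p. Poly_Mapping.single m (Poly_Mapping.lookup p m))"
  by (rule poly_mapping_eqI) (auto simp: lookup_sum lookup_single when_def in_keys_iff)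

lemma poly_mapping_single_induct [case_names single add]:
  fixes p :: "'a \<Rightarrow>\<^sub>0 'b::comm_monoid_add"
  assumes "\<And>m c. P (Poly_Mapping.single m c)" "\<And>p q. P p \<Longrightarrow> P q \<Longrightarrow> P (p + q)"
  shows "P p"
proof -
  have "P (\<Sum>m\<in>F. Poly_Mapping.single m (Poly_Mapping.lookup p m))" if "finite F" for F
    using that
  proof induction
    case empty
    then show ?case using assms(1)[of _ 0] by simp
  next
    case (insert x F)
    then show ?case using assms by simp
  qed
  then show ?thesis by (subst poly_mapping_sum_monomials) simp
qed

text \<open>Polynomial-valued counterpart of \<open>mpoly_eval\<close>: the substitutions used below
  have polynomial images, so numerators and denominators are moved by a ring homomorphism of
  \<open>mpoly\<close>.\<close>

definition msubst :: "(nat \<Rightarrow> mpoly) \<Rightarrow> mpoly \<Rightarrow> mpoly" where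
  "msubst s p = (\<Sum>m\<in>Poly_Mapping.keys p. mconst (Poly_Mapping.lookup p m) *
     (\<Prod>i\<in>Poly_Mapping.keys m. s i ^ Poly_Mapping.lookup m i))"

lemma mconst_mult: "mconst (a * b) = mconst a * mconst b"
  unfolding mult_single by simp

lemma msubst_superset:
  assumes "finite F" "Poly_Mapping.keys p \<subseteq> F"
  shows "msubst s p = (\<Sum>m\<in>F. mconst (Poly_Mapping.lookup p m) *
     (\<Prod>i\<in>Poly_Mapping.keys m. s i ^ Poly_Mapping.lookup m i))"
  unfolding msubst_def using assms
  by (intro sum.mono_neutral_left) (auto simp: in_keys_iff)

lemma msubst_add: "msubst s (p + q) = msubst s p + msubst s q"
proof -
  let ?F = "Poly_Mapping.keys p \<union> Poly_Mapping.keys q"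
  have "Poly_Mapping.keys (p + q) \<subseteq> ?F" by (rule Poly_Mapping.keys_add)
  then show ?thesis
    by (subst (1 2 3) msubst_superset[of ?F])
       (auto simp: lookup_add single_add distrib_right sum.distrib)
qed

lemma msubst_single:
  "msubst s (Poly_Mapping.single m c) =
     mconst c * (\<Prod>i\<in>Poly_Mapping.keys m. s i ^ Poly_Mapping.lookup m i)"
  by (subst msubst_superset[of "{m}"]) auto

lemma monomial_eval_add:
  fixes s :: "nat \<Rightarrow> 'a::comm_semiring_1"
  shows "(\<Prod>i\<in>Poly_Mapping.keys (m + n). s i ^ Poly_Mapping.lookup (m + n) i) =
    (\<Prod>i\<in>Poly_Mapping.keys m. s i ^ Poly_Mapping.lookup m i) *
    (\<Prod>i\<in>Poly_Mapping.keys n. s i ^ Poly_Mapping.lookup n i)"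
proof -
  let ?F = "Poly_Mapping.keys m \<union> Poly_Mapping.keys n"
  have *: "(\<Prod>i\<in>Poly_Mapping.keys k. s i ^ Poly_Mapping.lookup k i) =
      (\<Prod>i\<in>?F. s i ^ Poly_Mapping.lookup k i)" if "Poly_Mapping.keys k \<subseteq> ?F" for k
    using that by (intro prod.mono_neutral_left) (auto simp: in_keys_iff)
  show ?thesis
    by (subst (1 2 3) *)
      (auto simp: lookup_add power_add prod.distrib dest: subsetD[OF Poly_Mapping.keys_add])
qed

lemma msubst_mult: "msubst s (p * q) = msubst s p * msubst s q"
proof (induction p rule: poly_mapping_single_induct)
  case (single m c)
  show ?case
  proof (induction q rule: poly_mapping_single_induct)
    case (single n d)
    show ?case
      unfolding mult_single[of m c n d] msubst_single monomial_eval_add mconst_mult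
      by (simp only: mult_ac)
  next
    case (add p q)
    then show ?case by (simp add: msubst_add distrib_left)
  qed
next
  case (add p q)
  then show ?case by (simp add: msubst_add distrib_right)
qed

lemma msubst_const [simp]: "msubst s (mconst c) = mconst c"
  by (simp add: msubst_single)

lemma msubst_0 [simp]: "msubst s 0 = 0"
  by (simp add: msubst_def)

lemma msubst_1 [simp]: "msubst s 1 = 1"
  using msubst_const[of s 1] by (simp del: msubst_const)

lemma msubst_var [simp]: "msubst s (mvar i) = s i"
  by (simp add: mvar_def msubst_single)

lemma msubst_uminus: "msubst s (- p) = - msubst s p"
  by (metis add_eq_0_iff msubst_0 msubst_add)

lemma msubst_diff: "msubst s (p - q) = msubst s p - msubst s q"
  using msubst_add[of s p "- q"] by (simp add: msubst_uminus)

lemma msubst_sum: "msubst s (sum f F) = (\<Sum>i\<in>F. msubst s (f i))"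
  by (induction F rule: infinite_finite_induct) (simp_all add: msubst_add)

lemma msubst_prod: "msubst s (prod f F) = (\<Prod>i\<in>F. msubst s (f i))"
  by (induction F rule: infinite_finite_induct) (simp_all add: msubst_mult)

lemma msubst_power: "msubst s (p ^ n) = msubst s p ^ n"
  by (induction n) (simp_all add: msubst_mult)

lemma msubst_prod_list: "msubst s (prod_list xs) = prod_list (map (msubst s) xs)"
  by (induction xs) (simp_all add: msubst_mult)

lemma msubst_msubst: "msubst t (msubst s p) = msubst (\<lambda>i. msubst t (s i)) p"
  unfolding msubst_def[of s p] msubst_def[of "\<lambda>i. msubst t (s i)" p]
  by (simp add: msubst_sum msubst_mult msubst_prod msubst_power)

lemma msubst_cong:
  assumes "p \<in> mpolys r" "\<And>i. i \<in> {1..r} \<Longrightarrow> s i = t i"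
  shows "msubst s p = msubst t p"
  unfolding msubst_def using assms
  by (intro sum.cong prod.cong arg_cong2[where f="(*)"] refl) (fastforce simp: mpolys_def)

lemma monomial_prod: "(\<Prod>i\<in>Poly_Mapping.keys m. mvar i ^ Poly_Mapping.lookup m i) = Poly_Mapping.single m 1"
proof -
  have pw: "mvar i ^ n = Poly_Mapping.single (Poly_Mapping.single i n) 1" for i n
    by (induction n) (simp_all add: mvar_def mult_single flip: single_add)
  have "(\<Prod>i\<in>F. mvar i ^ Poly_Mapping.lookup m i) =
    Poly_Mapping.single (\<Sum>i\<in>F. Poly_Mapping.single i (Poly_Mapping.lookup m i)) 1" for F
    by (induction F rule: infinite_finite_induct) (simp_all add: pw mult_single del: One_nat_def)
  then show ?thesis using poly_mapping_sum_monomials[of m] by simp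
qed

lemma msubst_mvar: "msubst mvar p = p"
  unfolding msubst_def monomial_prod
  by (subst (3) poly_mapping_sum_monomials) (simp add: mult_single)

subsection \<open>Evaluation of rational functions\<close>

lemma of_mpoly_0 [simp]: "of_mpoly 0 = 0"
  by (simp add: of_mpoly_eq_0_iff)

lemma of_mpoly_1 [simp]: "of_mpoly 1 = 1"
  by (simp add: of_mpoly_def One_fract_def)

lemma of_mpoly_uminus: "of_mpoly (- p) = - of_mpoly p"
  by (simp add: of_mpoly_def)

lemma of_mpoly_diff: "of_mpoly (p - q) = of_mpoly p - of_mpoly q"
  by (simp add: of_mpoly_def)

lemma of_mpoly_sum: "of_mpoly (sum f F) = (\<Sum>i\<in>F. of_mpoly (f i))"
  by (induction F rule: infinite_finite_induct) (simp_all add: of_mpoly_add)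

lemma of_mpoly_prod: "of_mpoly (prod f F) = (\<Prod>i\<in>F. of_mpoly (f i))"
  by (induction F rule: infinite_finite_induct) (simp_all add: of_mpoly_mult)

lemma of_mpoly_power: "of_mpoly (p ^ n) = of_mpoly p ^ n"
  by (induction n) (simp_all add: of_mpoly_mult)

lemma of_mpoly_eq_iff [simp]: "of_mpoly p = of_mpoly q \<longleftrightarrow> p = q"
  using of_mpoly_eq_0_iff[of "p - q"] by (simp add: of_mpoly_diff)

lemma of_mpoly_quot: "d \<noteq> 0 \<Longrightarrow> of_mpoly n / of_mpoly d = Fract n d"
  by (simp add: of_mpoly_def)

lemma mpoly_eval_of_mpoly: "mpoly_eval (\<lambda>i. of_mpoly (s i)) p = of_mpoly (msubst s p)"
  by (simp add: mpoly_eval_def msubst_def of_mpoly_sum of_mpoly_mult of_mpoly_prod of_mpoly_power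
      rat_const_def)

text \<open>Two fractions for the same rational function satisfy n q = p d, and the ring
  homomorphism \<open>msubst s\<close> preserves this equation. So the value is independent of the
  representative, as the \<open>THE\<close> requires.\<close>

lemma ratfun_subst_quot:
  assumes "msubst s d \<noteq> 0"
  shows "ratfun_subst (\<lambda>i. of_mpoly (s i)) (of_mpoly n / of_mpoly d) =
    of_mpoly (msubst s n) / of_mpoly (msubst s d)"
proof -
  have d: "d \<noteq> 0" using assms by auto
  have *: "y = of_mpoly (msubst s n) / of_mpoly (msubst s d)"
    if "q \<noteq> 0" "Fract n d = Fract p q" "msubst s q \<noteq> 0"
      "y = of_mpoly (msubst s p) / of_mpoly (msubst s q)" for y p q
  proof -
    have "n * q = p * d" using that(1,2) d by (simp add: eq_fract)
    then have "msubst s n * msubst s q = msubst s p * msubst s d"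
      by (metis msubst_mult)
    then show ?thesis using that assms
      by (simp add: of_mpoly_quot eq_fract)
  qed
  show ?thesis
    unfolding ratfun_subst_def mpoly_eval_of_mpoly of_mpoly_quot[OF d]
  proof (rule the_equality)
    show "\<exists>p q. q \<noteq> 0 \<and> Fract n d = Fract p q \<and> of_mpoly (msubst s q) \<noteq> 0 \<and>
        of_mpoly (msubst s n) / of_mpoly (msubst s d) =
        of_mpoly (msubst s p) / of_mpoly (msubst s q)"
      using d assms by (intro exI[of _ n] exI[of _ d]) (simp add: of_mpoly_eq_0_iff)
  qed (metis * of_mpoly_0)
qed

text \<open>The index shift and the default value 0 copy the substitution inside
  \<open>mould_at\<close>.\<close>

definition list_subst :: "mpoly list \<Rightarrow> mpoly \<Rightarrow> mpoly" where
  "list_subst ys = msubst (\<lambda>i. if 1 \<le> i \<and> i \<le> length ys then ys ! (i - 1) else 0)"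

lemma mould_at_quot:
  assumes "A (length ys) = of_mpoly n / of_mpoly d" "list_subst ys d \<noteq> 0"
  shows "mould_at A (map of_mpoly ys) = of_mpoly (list_subst ys n) / of_mpoly (list_subst ys d)"
proof -
  have "(\<lambda>i. if 1 \<le> i \<and> i \<le> length (map of_mpoly ys) then map of_mpoly ys ! (i - 1) else 0) =
    (\<lambda>i. of_mpoly (if 1 \<le> i \<and> i \<le> length ys then ys ! (i - 1) else 0))"
    by (auto simp: fun_eq_iff)
  then show ?thesis
    unfolding mould_at_def using assms ratfun_subst_quot by (simp add: list_subst_def)
qed

lemma mould_at_of_mpoly:
  "A (length ys) = of_mpoly n \<Longrightarrow> mould_at A (map of_mpoly ys) = of_mpoly (list_subst ys n)"
  using mould_at_quot[of A ys n 1] by (simp add: list_subst_def)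

lemma msubst_list_subst: "msubst s (list_subst ys p) = list_subst (map (msubst s) ys) p"
  unfolding list_subst_def msubst_msubst
  by (rule arg_cong[of _ _ "\<lambda>s. msubst s p"]) (auto simp: fun_eq_iff)

lemma list_subst_list_subst:
  "list_subst xs (list_subst ys p) = list_subst (map (list_subst xs) ys) p"
  by (simp add: list_subst_def[of xs] msubst_list_subst)

lemma list_subst_mvar [simp]: "1 \<le> i \<Longrightarrow> i \<le> length ys \<Longrightarrow> list_subst ys (mvar i) = ys ! (i - 1)"
  by (simp add: list_subst_def del: One_nat_def)

lemma map_list_subst_mvars:
  "length ys = r \<Longrightarrow> map (list_subst ys) (mvars r) = ys"
  by (auto intro!: nth_equalityI simp: mvars_def simp del: One_nat_def upt_Suc)

lemma list_subst_mvars: "p \<in> mpolys r \<Longrightarrow> list_subst (mvars r) p = p"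
  unfolding list_subst_def
  by (subst msubst_cong[where t=mvar]) (auto simp: msubst_mvar)

lemma list_subst_add: "list_subst xs (p + q) = list_subst xs p + list_subst xs q"
  and list_subst_mult: "list_subst xs (p * q) = list_subst xs p * list_subst xs q"
  and list_subst_diff: "list_subst xs (p - q) = list_subst xs p - list_subst xs q"
  and list_subst_uminus: "list_subst xs (- p) = - list_subst xs p"
  and list_subst_const: "list_subst xs (mconst c) = mconst c"
  by (simp_all add: list_subst_def msubst_add msubst_mult msubst_diff msubst_uminus)

lemma list_subst_prod_list: "list_subst xs (prod_list ys) = prod_list (map (list_subst xs) ys)"
  by (simp add: list_subst_def msubst_prod_list)

lemma list_subst_sum_list: "list_subst xs (sum_list ys) = sum_list (map (list_subst xs) ys)"
  unfolding list_subst_def by (induction ys) (simp_all add: msubst_add)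

section \<open>Cyclic form of moulds\<close>

fun steps :: "'a::ab_group_add list \<Rightarrow> 'a list" where
  "steps (x # y # zs) = (y - x) # steps (y # zs)"
| "steps [x] = []"
| "steps [] = []"

lemma length_steps [simp]: "length (steps xs) = length xs - 1"
  by (induction xs rule: steps.induct) auto

lemma steps_append: "steps (xs @ x # y # ys) = steps (xs @ [x]) @ (y - x) # steps (y # ys)"
  by (induction xs rule: steps.induct) auto

lemma steps_snoc: "zs \<noteq> [] \<Longrightarrow> steps (zs @ [x]) = steps zs @ [x - last zs]"
  by (induction zs rule: steps.induct) auto

lemma steps_Cons: "zs \<noteq> [] \<Longrightarrow> steps (x # zs) = (hd zs - x) # steps zs"
  by (cases zs) auto

lemma map_steps:
  assumes "\<And>x y. h (x - y) = h x - h y"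
  shows "map h (steps xs) = steps (map h xs)"
  using assms by (induction xs rule: steps.induct) auto

lemma sum_list_steps: "xs \<noteq> [] \<Longrightarrow> sum_list (steps xs) = last xs - hd xs"
  by (induction xs rule: steps.induct) auto

lemma zero_notin_steps: "distinct xs \<Longrightarrow> 0 \<notin> set (steps xs)"
  by (induction xs rule: steps.induct) auto

lemma steps_map_upt: "steps (map f [a..<b]) = map (\<lambda>i. f (Suc i) - f i) [a..<b - 1]"
proof (induction b)
  case (Suc b)
  show ?case
  proof (cases "a < b")
    case True
    then have "steps (map f [a..<Suc b]) = steps (map f [a..<b]) @ [f b - f (b - 1)]"
      by (simp add: steps_snoc last_map)
    also have "\<dots> = map (\<lambda>i. f (Suc i) - f i) [a..<Suc (b - 1)]"
      using Suc True by (subst upt_Suc) auto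
    finally show ?thesis using True by simp
  qed (auto simp: le_Suc_eq not_less)
qed auto

lemma distinct_last_neq_hd: "distinct xs \<Longrightarrow> length xs \<ge> 2 \<Longrightarrow> last xs \<noteq> hd xs"
  by (cases xs) (auto split: if_splits)

definition push_poly :: "nat \<Rightarrow> mpoly \<Rightarrow> bool" where
  "push_poly r p \<longleftrightarrow> list_subst (- sum_list (mvars r) # butlast (mvars r)) p = p"

text \<open>If \<open>p\<close> represents the depth \<open>r\<close> part of \<open>\<Delta> M\<close>, then \<open>cyc_frac p [x\<^sub>0,\<dots>,x\<^sub>r]\<close> is
  \<open>M(x\<^sub>1 - x\<^sub>0, \<dots>, x\<^sub>r - x\<^bsub>r-1\<^esub>)\<close>. The push operator becomes the rotation of the \<open>r + 1\<close> points.\<close>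

definition cyc_frac :: "mpoly \<Rightarrow> mpoly list \<Rightarrow> ratfun" where
  "cyc_frac p xs =
     of_mpoly (list_subst (steps xs) p) / of_mpoly (prod_list (steps xs) * (last xs - hd xs))"

text \<open>The defining identity is between generic variables; substituting \<open>ys\<close> into
  it specialises it to arbitrary arguments.\<close>

lemma push_polyD:
  assumes "push_poly r p" "length ys = r"
  shows "list_subst (- sum_list ys # butlast ys) p = list_subst ys p"
proof -
  have "list_subst ys p = list_subst ys (list_subst (- sum_list (mvars r) # butlast (mvars r)) p)"
    using assms by (simp add: push_poly_def)
  also have "\<dots> = list_subst (- sum_list ys # butlast ys) p"
    using map_list_subst_mvars[OF assms(2)]
    by (simp add: list_subst_list_subst map_butlast list_subst_sum_list
        list_subst_uminus del: upt_Suc)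
  finally show ?thesis by simp
qed

text \<open>The negated sum of the steps of \<open>zs @ [x]\<close> is \<open>hd zs - x\<close>, so
  the push turns these steps into those of \<open>x # zs\<close>. The denominator is the product of
  all differences around the cycle: two factors change sign, and the signs cancel.\<close>

lemma cyc_frac_rotate1:
  assumes "push_poly r p" "length zs = r" "r \<ge> 1"
  shows "cyc_frac p (x # zs) = cyc_frac p (zs @ [x])"
proof -
  have ne: "zs \<noteq> []" using assms by auto
  have "list_subst (- sum_list (steps (zs @ [x])) # butlast (steps (zs @ [x]))) p =
      list_subst (steps (zs @ [x])) p"
    using assms by (intro push_polyD) auto
  then have "list_subst (steps (x # zs)) p = list_subst (steps (zs @ [x])) p"
    using ne by (subst (asm) sum_list_steps) (simp_all add: steps_snoc steps_Cons)
  moreover have "prod_list (steps (x # zs)) * (last (x # zs) - hd (x # zs)) =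
      prod_list (steps (zs @ [x])) * (last (zs @ [x]) - hd (zs @ [x]))"
    using ne by (simp add: steps_snoc steps_Cons algebra_simps)
  ultimately show ?thesis by (simp only: cyc_frac_def)
qed

lemma cyc_frac_append_commute:
  assumes "push_poly r p" "length (xs @ ys) = r + 1" "r \<ge> 1"
  shows "cyc_frac p (xs @ ys) = cyc_frac p (ys @ xs)"
  using assms(2)
proof (induction xs arbitrary: ys)
  case (Cons x xs)
  then show ?case
    using cyc_frac_rotate1[OF assms(1) _ assms(3), of "xs @ ys" x] Cons.IH[of "ys @ [x]"]
    by simp
qed simp

section \<open>Values of A' and of the inverse of Delta at consecutive differences\<close>

lemma var_u_eq: "var_u = of_mpoly \<circ> mvar"
  by (auto simp: fun_eq_iff var_u_def mvar_def)

lemma map_var_u: "map var_u is = map of_mpoly (map mvar is)"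
  by (simp add: var_u_eq)

lemma prod_var_u: "(\<Prod>i = 1..r. var_u i) = of_mpoly (prod_list (mvars r))"
  by (induction r) (simp_all add: mvars_Suc var_u_eq of_mpoly_mult mult.commute)

lemma ubar_eq: "ubar r = of_mpoly (sum_list (mvars r))"
  by (induction r) (simp_all add: mvars_Suc ubar_def var_u_eq of_mpoly_add)

lemma prod_list_0_iff: "prod_list xs = 0 \<longleftrightarrow> 0 \<in> set (xs :: mpoly list)"
  by (induction xs) auto

lemma mould_at_mprime:
  assumes "A (length ys) = of_mpoly p" "length ys \<ge> 1" "0 \<notin> set ys"
  shows "mould_at (mprime A) (map of_mpoly ys) = of_mpoly (list_subst ys p) / of_mpoly (prod_list ys)"
proof -
  have "list_subst ys (prod_list (mvars (length ys))) = prod_list ys"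
    by (simp only: list_subst_prod_list map_list_subst_mvars)
  moreover have "length ys \<noteq> 0" using assms(2) by linarith
  then have "mprime A (length ys) = of_mpoly p / of_mpoly (prod_list (mvars (length ys)))"
    using assms(1) by (simp only: mprime_def prod_var_u if_False)
  ultimately show ?thesis
    using mould_at_quot[of "mprime A" ys p "prod_list (mvars (length ys))"] assms(3)
    by (simp add: prod_list_0_iff)
qed

lemma inv_mDelta: "inv mDelta A r = (if r = 0 then A 0 else A r / ((\<Prod>i = 1..r. var_u i) * ubar r))"
proof -
  let ?D = "\<lambda>r. if r = 0 then A 0 else A r / ((\<Prod>i = 1..r. var_u i) * ubar r)"
  have "mDelta ?D = A"
    using ubar_nonzero var_u_nonzero by (auto simp: fun_eq_iff mDelta_def)
  then have "inv mDelta A = ?D" using inv_f_f[OF bij_is_inj[OF bij_mDelta], of ?D] by (simp only:)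
  then show ?thesis by simp
qed

lemma mould_at_inv_mDelta:
  assumes "A (length ys) = of_mpoly p" "length ys \<ge> 1" "0 \<notin> set ys" "sum_list ys \<noteq> 0"
  shows "mould_at (inv mDelta A) (map of_mpoly ys) =
    of_mpoly (list_subst ys p) / of_mpoly (prod_list ys * sum_list ys)"
proof -
  let ?U = "mvars (length ys)"
  have "list_subst ys (prod_list ?U * sum_list ?U) = prod_list ys * sum_list ys"
    by (simp only: list_subst_mult list_subst_prod_list list_subst_sum_list map_list_subst_mvars)
  moreover have "length ys \<noteq> 0" using assms(2) by linarith
  then have "inv mDelta A (length ys) = of_mpoly p / of_mpoly (prod_list ?U * sum_list ?U)"
    using assms(1) by (simp only: inv_mDelta prod_var_u ubar_eq of_mpoly_mult if_False)
  ultimately show ?thesis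
    using mould_at_quot[of "inv mDelta A" ys p "prod_list ?U * sum_list ?U"] assms(3,4)
    by (simp add: prod_list_0_iff)
qed

text \<open>Distinct points make every step nonzero, and the steps telescope to the nonzero
  \<open>last xs - hd xs\<close>; the substituted denominator is therefore exactly that of
  \<open>cyc_frac\<close>.\<close>

lemma mould_at_inv_mDelta_steps:
  assumes "A r = of_mpoly p" "r \<ge> 1" "length xs = r + 1" "distinct xs"
  shows "mould_at (inv mDelta A) (map of_mpoly (steps xs)) = cyc_frac p xs"
proof -
  have "xs \<noteq> []" using assms by auto
  then show ?thesis
    using assms zero_notin_steps[of xs] distinct_last_neq_hd[of xs]
    by (subst mould_at_inv_mDelta[of _ _ p]) (auto simp: cyc_frac_def sum_list_steps)
qed

text \<open>A' is M times u_1 + ... + u_r, and this sum telescopes to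
  \<open>last xs - hd xs\<close>.\<close>

lemma mould_at_mprime_steps:
  assumes "A r = of_mpoly p" "r \<ge> 1" "length xs = r + 1" "distinct xs"
  shows "mould_at (mprime A) (map of_mpoly (steps xs)) = cyc_frac p xs * of_mpoly (last xs - hd xs)"
  using assms zero_notin_steps[of xs] distinct_last_neq_hd[of xs]
  by (subst mould_at_mprime[of _ _ p]) (auto simp: cyc_frac_def of_mpoly_mult of_mpoly_eq_0_iff)

text \<open>Under \<open>push_poly\<close>, rotating the points turns this into the sum over all
  ways to insert 0 into the cyclic word \<open>xs\<close>. Both the circular sum and the Fay
  operator reduce to it.\<close>

definition cyc_sum :: "mpoly \<Rightarrow> mpoly list \<Rightarrow> ratfun" where
  "cyc_sum p xs = (\<Sum>k<length xs. cyc_frac p (0 # rotate k xs))"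

subsection \<open>Circ-neutrality of the swap\<close>

lemma distinct_mvars: "distinct (0 # mvars r)"
  by (auto simp: mvars_def distinct_map inj_on_def)

lemma steps_rev_mvars:
  "steps (rev (mvars (Suc n))) = map (\<lambda>i. mvar i - mvar (i + 1)) (rev [1..<Suc n])"
  by (induction n) (simp_all add: mvars_Suc)

text \<open>The arguments v_r, v_(r-1) - v_r, ..., v_1 - v_2 are the steps of the points 0, v_r,
  ..., v_1.\<close>

lemma mould_swap_inv_mDelta:
  assumes "A r = of_mpoly p" "r \<ge> 1"
  shows "mould_swap (inv mDelta A) r = cyc_frac p (0 # rev (mvars r))"
proof -
  obtain n where r: "r = Suc n" using assms(2) by (cases r) auto
  have "var_u r # map (\<lambda>i. var_u i - var_u (i + 1)) (rev [1..<r]) =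
      map of_mpoly (steps (0 # rev (mvars r)))"
    using steps_rev_mvars[of n] by (simp add: r mvars_Suc var_u_eq of_mpoly_diff del: upt_Suc)
  then show ?thesis
    using mould_at_inv_mDelta_steps[of A r p "0 # rev (mvars r)"] assms distinct_mvars[of r]
    by (simp add: mould_swap_def)
qed

text \<open>Substitution is computed on a single fraction, so the constant is first put over the
  common denominator; distinctness of 0 and \<open>ys\<close> keeps that denominator
  nonzero.\<close>

lemma mould_at_cyc_frac:
  assumes B: "B r = cyc_frac p (0 # rev (mvars r)) + rat_const c"
    and r: "r \<ge> 1" "length ys = r" "distinct (0 # ys)"
  shows "mould_at B (map of_mpoly ys) = cyc_frac p (0 # rev ys) + rat_const c"
proof -
  let ?den = "\<lambda>xs. prod_list (steps xs) * (last xs - hd xs)"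
  let ?xs = "0 # rev (mvars r)" and ?xs' = "0 # rev ys"
  have nz: "?den xs \<noteq> 0" if "distinct xs" "length xs = r + 1" for xs :: "mpoly list"
    using that zero_notin_steps[of xs] distinct_last_neq_hd[of xs] r(1)
    by (simp add: prod_list_0_iff)
  have dist: "distinct ?xs" "distinct ?xs'"
    using distinct_mvars[of r] r by auto
  have m: "map (list_subst ys) ?xs = ?xs'"
    using map_list_subst_mvars[OF r(2)] list_subst_const[of ys 0] by (simp flip: rev_map)
  have st: "map (list_subst ys) (steps ?xs) = steps ?xs'"
    by (simp only: map_steps list_subst_diff m)
  have "?den ?xs \<noteq> 0" "?den ?xs' \<noteq> 0"
    using nz[OF dist(1)] nz[OF dist(2)] r(2) by (simp_all only: length_Cons length_rev length_mvars Suc_eq_plus1 simp_thms)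
  have "list_subst ys (last ?xs) = last ?xs'" "list_subst ys (hd ?xs) = hd ?xs'"
    using m by (metis last_map list.discI, metis list.sel(1) list.simps(9))
  then have den: "list_subst ys (?den ?xs) = ?den ?xs'"
    by (simp only: list_subst_mult list_subst_prod_list st list_subst_diff)
  let ?n = "list_subst (steps ?xs) p + mconst c * ?den ?xs"
  have "B (length ys) = of_mpoly ?n / of_mpoly (?den ?xs)"
    using \<open>?den ?xs \<noteq> 0\<close> unfolding B r(2) cyc_frac_def of_mpoly_add add_divide_distrib rat_const_def
    by (simp only: of_mpoly_mult[of "mconst c"]) (simp add: of_mpoly_eq_0_iff)
  then have "mould_at B (map of_mpoly ys) = of_mpoly (list_subst ys ?n) / of_mpoly (?den ?xs')"
    using mould_at_quot[of B ys ?n "?den ?xs"] den \<open>?den ?xs' \<noteq> 0\<close> by metis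
  also have "list_subst ys ?n = list_subst (steps ?xs') p + mconst c * ?den ?xs'"
    by (simp only: list_subst_add list_subst_mult[of _ "mconst c"] den list_subst_list_subst st
        list_subst_const)
  also have "of_mpoly \<dots> / of_mpoly (?den ?xs') = cyc_frac p ?xs' + rat_const c"
    using \<open>?den ?xs' \<noteq> 0\<close> unfolding cyc_frac_def of_mpoly_add add_divide_distrib rat_const_def
    by (simp only: of_mpoly_mult[of "mconst c"]) (simp add: of_mpoly_eq_0_iff)
  finally show ?thesis .
qed

text \<open>Reversal turns rotation by k into rotation by n - k, where n is the length; reducing mod
  n keeps k = 0 in range and makes the index map an involution.\<close>

lemma sum_rev_rotate:
  "(\<Sum>k<length xs. f (rev (rotate k xs))) = (\<Sum>k<length xs. f (rotate k (rev xs)))"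
proof (rule sum.reindex_bij_witness[where i="\<lambda>k. (length xs - k) mod length xs"
      and j="\<lambda>k. (length xs - k) mod length xs"])
  have inv: "(length xs - (length xs - k) mod length xs) mod length xs = k"
    if "k \<in> {..<length xs}" for k
    using that by (cases "k = 0") auto
  then show "\<And>k. k \<in> {..<length xs} \<Longrightarrow>
      (length xs - (length xs - k) mod length xs) mod length xs = k"
    "\<And>k. k \<in> {..<length xs} \<Longrightarrow>
      (length xs - (length xs - k) mod length xs) mod length xs = k" by blast+
  show "(length xs - k) mod length xs \<in> {..<length xs}"
    "(length xs - k) mod length xs \<in> {..<length xs}" if "k \<in> {..<length xs}" for k
    using that by (auto intro!: mod_less_divisor)
  show "f (rotate ((length xs - k) mod length xs) (rev xs)) = f (rev (rotate k xs))"
    if "k \<in> {..<length xs}" for k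
    using that inv[OF that] rotate_conv_mod[of "length xs - (length xs - k) mod length xs" xs]
    by (simp add: rotate_rev)
qed

text \<open>The swap reverses every rotated word, and \<open>sum_rev_rotate\<close> moves the
  reversal inside the rotation. The constant occurs once in each of the r terms.\<close>

lemma circ_sum_mould_swap:
  assumes "A r = of_mpoly p" "r \<ge> 1" "C r = rat_const c"
  shows "(\<Sum>k<r. mould_at (mould_swap (inv mDelta A) + C) (rotate k (map var_u [1..<r + 1]))) =
    cyc_sum p (rev (mvars r)) + of_nat r * rat_const c"
proof -
  let ?B = "mould_swap (inv mDelta A) + C"
  have "mould_at ?B (rotate k (map var_u [1..<r + 1])) =
      cyc_frac p (0 # rev (rotate k (mvars r))) + rat_const c" for k
  proof -
    have "rotate k (map var_u [1..<r + 1]) = map of_mpoly (rotate k (mvars r))"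
      by (simp only: map_var_u mvars_def rotate_map)
    moreover have "?B r = cyc_frac p (0 # rev (mvars r)) + rat_const c"
      using mould_swap_inv_mDelta[of A r p] assms by simp
    ultimately show ?thesis
      using mould_at_cyc_frac[of ?B r p c "rotate k (mvars r)"] assms distinct_mvars[of r] by simp
  qed
  then show ?thesis
    using sum_rev_rotate[of "\<lambda>xs. cyc_frac p (0 # xs)" "mvars r"]
    by (simp add: sum.distrib cyc_sum_def del: upt_Suc One_nat_def)
qed

subsection \<open>The Fay operator\<close>

definition psum :: "nat \<Rightarrow> mpoly" where
  "psum i = sum_list (mvars i)"

definition psums :: "nat \<Rightarrow> mpoly list" where
  "psums r = map psum [1..<r + 1]"

lemma psum_0 [simp]: "psum 0 = 0"
  by (simp add: psum_def)

lemma psum_Suc: "psum (Suc i) = psum i + mvar (Suc i)"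
  by (simp add: psum_def mvars_Suc)

lemma ubar_psum: "ubar i = of_mpoly (psum i)"
  by (simp add: ubar_eq psum_def)

lemma length_psums [simp]: "length (psums r) = r"
  by (simp add: psums_def)

text \<open>The substitution carries \<open>[u\<^sub>r, \<dots>, u\<^sub>1]\<close> to the partial sums \<open>[u\<^sub>1, u\<^sub>1 + u\<^sub>2, \<dots>]\<close>.\<close>

definition to_psums :: "nat \<Rightarrow> nat \<Rightarrow> mpoly" where
  "to_psums r i = (if 1 \<le> i \<and> i \<le> r then psum (r + 1 - i) else mvar i)"

text \<open>Successive differences undo partial sums. Both maps fix the variables outside 1..r, so
  that \<open>to_psums\<close> is undone on all of \<open>mpoly\<close>.\<close>

definition from_psums :: "nat \<Rightarrow> nat \<Rightarrow> mpoly" where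
  "from_psums r i = (if i = 1 \<and> 1 \<le> r then mvar r
     else if 2 \<le> i \<and> i \<le> r then mvar (r + 1 - i) - mvar (r + 2 - i) else mvar i)"

lemma msubst_from_psums: "1 \<le> i \<Longrightarrow> i \<le> r \<Longrightarrow> msubst (from_psums r) (psum i) = mvar (r + 1 - i)"
proof (induction i)
  case (Suc i)
  show ?case
  proof (cases "i = 0")
    case True
    then show ?thesis using Suc.prems by (simp add: psum_Suc from_psums_def)
  next
    case False
    then have "from_psums r (Suc i) = mvar (r + 1 - Suc i) - mvar (r + 2 - Suc i)"
      using Suc.prems by (simp add: from_psums_def)
    then have "msubst (from_psums r) (psum (Suc i)) =
        mvar (r + 1 - i) + (mvar (r + 1 - Suc i) - mvar (r + 2 - Suc i))"
      using Suc False by (simp add: psum_Suc msubst_add)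
    then show ?thesis using Suc.prems by simp
  qed
qed simp

lemma msubst_from_to_psums: "msubst (from_psums r) (msubst (to_psums r) p) = p"
proof -
  have "msubst (from_psums r) (to_psums r i) = mvar i" for i
    by (auto simp: to_psums_def msubst_from_psums from_psums_def)
  then show ?thesis by (simp add: msubst_msubst msubst_mvar)
qed

lemma map_to_psums: "map (msubst (to_psums r)) (rev (mvars r)) = psums r"
  by (rule nth_equalityI) (auto simp: psums_def mvars_def rev_nth to_psums_def simp del: upt_Suc)

lemma distinct_psums: "distinct (0 # psums r)"
proof -
  have "0 # psums r = map (msubst (to_psums r)) (0 # rev (mvars r))"
    by (simp add: map_to_psums)
  moreover have "inj (msubst (to_psums r))"
    by (metis injI msubst_from_to_psums)
  moreover have "distinct (0 # rev (mvars r))"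
    using distinct_mvars[of r] by simp
  ultimately show ?thesis by (metis distinct_map inj_on_subset subset_UNIV)
qed

lemma steps_map_psum:
  "steps (map psum [a..<b]) = map mvar [a + 1..<b]"
proof -
  have "steps (map psum [a..<b]) = map (mvar \<circ> Suc) [a..<b - 1]"
    by (simp add: steps_map_upt psum_Suc comp_def)
  also have "\<dots> = map mvar (map Suc [a..<b - 1])" by simp
  also have "map Suc [a..<b - 1] = [a + 1..<b]"
    by (cases b) (simp_all add: map_Suc_upt)
  finally show ?thesis .
qed

text \<open>Each of the r + 1 terms is a value of A' at the steps of the partial sums with 0
  inserted somewhere, hence a cyclic fraction times last minus first point. With 0 in the interior
  this factor is \<open>psum r - psum 1\<close>; with 0 at the front or at the end the cyclic
  fraction is the same, and the factors \<open>psum r\<close> and \<open>- psum 1\<close> add up to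
  it.\<close>

lemma fay_mprime:
  assumes A: "A r = of_mpoly p" "p \<in> mpolys r" and push: "push_poly r p" and r: "r \<ge> 2"
  shows "fay (mprime A) r = of_mpoly (psum r - psum 1) * cyc_sum p (psums r)"
proof -
  let ?W = "psums r"
  define K where "K k = cyc_frac p (0 # rotate k ?W)" for k
  have r1: "r \<ge> 1" using r by simp
  \<comment> \<open>Moving the prefix behind the rest brings 0 to the front and rotates the word by
    k.\<close>
  have K: "cyc_frac p (take k ?W @ 0 # drop k ?W) = K k" if "k < r" for k
    using cyc_frac_append_commute[OF push, of "take k ?W" "0 # drop k ?W"] that r
    by (simp add: K_def rotate_drop_take)
  have at: "mould_at (mprime A) (map of_mpoly (steps xs)) =
      cyc_frac p xs * of_mpoly (last xs - hd xs)" if "mset xs = mset (0 # ?W)" for xs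
  proof -
    have "length xs = r + 1" using mset_eq_length[OF that] by simp
    moreover have "distinct xs" using mset_eq_imp_distinct_iff[OF that] distinct_psums by blast
    ultimately show ?thesis using mould_at_mprime_steps[of A r p, OF A(1) r1] by blast
  qed
  have W0: "0 # ?W = map psum [0..<r + 1]"
    using r by (simp add: psums_def upt_conv_Cons[of 0])
  have W1: "?W = psum 1 # map psum [2..<r + 1]"
    using r upt_conv_Cons[of 1 "r + 1"] by (simp add: psums_def numeral_2_eq_2 del: upt_Suc)
  have Wl: "last ?W = psum r" "?W \<noteq> []"
    using r by (simp_all add: psums_def)
  have st0: "steps (0 # ?W) = mvars r"
    unfolding W0 steps_map_psum mvars_def by simp
  have "mprime A r = mould_at (mprime A) (map of_mpoly (steps (0 # ?W)))"
    using mould_at_mprime[of A "mvars r" p] A r distinct_mvars[of r]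
    by (simp add: st0 list_subst_mvars mprime_def prod_var_u del: One_nat_def)
  also have "\<dots> = K 0 * of_mpoly (psum r)"
    by (subst at) (use Wl in \<open>simp_all add: K_def\<close>)
  finally have t1: "mprime A r = K 0 * of_mpoly (psum r)" .
  have stW: "steps ?W = map mvar [2..<r + 1]"
    by (simp add: psums_def steps_map_psum numeral_2_eq_2 del: upt_Suc)
  have "map var_u [2..<r + 1] @ [- ubar r] = map of_mpoly (steps (?W @ [0]))"
    unfolding steps_snoc[OF Wl(2)] stW Wl(1)
    by (simp add: map_var_u ubar_psum of_mpoly_uminus del: upt_Suc map_map)
  then have "mould_at (mprime A) (map var_u [2..<r + 1] @ [- ubar r]) =
      cyc_frac p (?W @ [0]) * of_mpoly (- psum 1)"
    by (simp only:) (subst at, use W1 in simp_all)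
  also have "cyc_frac p (?W @ [0]) = K 0"
    using cyc_frac_rotate1[OF push _ r1, of ?W 0] by (simp add: K_def)
  finally have t2: "mould_at (mprime A) (map var_u [2..<r + 1] @ [- ubar r]) =
      K 0 * of_mpoly (- psum 1)" .
  have t3: "mould_at (mprime A)
      (map var_u [2..<i + 1] @ [- ubar i, ubar (i + 1)] @ map var_u [i + 2..<r + 1]) =
      K i * of_mpoly (psum r - psum 1)" if i: "i \<in> {1..r - 1}" for i
  proof -
    have ir: "1 \<le> i" "i < r" using i r by auto
    let ?xs = "take i ?W @ 0 # drop i ?W"
    have tk: "take i ?W = map psum [1..<i + 1]" and dr: "drop i ?W = map psum [i + 1..<r + 1]"
      using ir by (simp_all add: psums_def take_map drop_map take_upt del: upt_Suc)
    have d1: "drop i ?W = psum (i + 1) # map psum [i + 2..<r + 1]"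
      unfolding dr using ir by (simp add: upt_conv_Cons[of "Suc i"] del: upt_Suc)
    \<comment> \<open>The step into 0 is \<open>- psum i\<close> and the step out of it is
      \<open>psum (i + 1)\<close>: these are the two special arguments of the i-th Fay term.\<close>
    have "?xs = take i ?W @ 0 # psum (i + 1) # map psum [i + 2..<r + 1]"
      by (simp add: d1)
    then have "steps ?xs = steps (take i ?W @ [0]) @ psum (i + 1) # steps (drop i ?W)"
      by (simp only: steps_append d1) simp
    also have "steps (take i ?W @ [0]) = map mvar [2..<i + 1] @ [- psum i]"
    proof -
      have "map psum [1..<i + 1] \<noteq> []" "last (map psum [1..<i + 1]) = psum i"
        using ir by (simp_all add: last_map)
      then show ?thesis
        unfolding tk by (simp add: steps_snoc steps_map_psum numeral_2_eq_2 del: upt_Suc)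
    qed
    also have "steps (drop i ?W) = map mvar [i + 2..<r + 1]"
      unfolding dr steps_map_psum by simp
    finally have "map var_u [2..<i + 1] @ [- ubar i, ubar (i + 1)] @ map var_u [i + 2..<r + 1] =
        map of_mpoly (steps ?xs)"
      by (simp add: map_var_u ubar_psum of_mpoly_uminus del: upt_Suc map_map)
    moreover have "mset ?xs = mset (0 # ?W)"
      by (metis append_take_drop_id mset.simps(2) mset_append union_mset_add_mset_right)
    moreover have "last ?xs = psum r"
      using ir Wl by (simp add: last_append)
    moreover have "hd ?xs = psum 1"
      using ir W1 by (simp add: tk hd_append upt_conv_Cons del: upt_Suc)
    ultimately show ?thesis using at[of ?xs] K[OF ir(2)] by simp
  qed
  have "{..<r} = insert 0 {1..r - 1}" using r by auto
  then have "cyc_sum p ?W = K 0 + (\<Sum>i = 1..r - 1. K i)"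
    by (simp add: cyc_sum_def K_def)
  moreover have "fay (mprime A) r = K 0 * of_mpoly (psum r) + K 0 * of_mpoly (- psum 1) +
      (\<Sum>i = 1..r - 1. K i * of_mpoly (psum r - psum 1))"
    unfolding fay_def t1 t2 by (intro arg_cong2[where f="(+)"] refl sum.cong t3)
  ultimately show ?thesis
    by (simp add: algebra_simps sum_distrib_left sum_distrib_right of_mpoly_diff of_mpoly_uminus)
qed

subsection \<open>Change of variables\<close>

lemma ratfun_cases:
  obtains n d where "d \<noteq> 0" "x = of_mpoly n / of_mpoly d"
  by (cases x) (metis of_mpoly_quot)

context
  fixes s :: "nat \<Rightarrow> mpoly"
  assumes inj: "inj (msubst s)"
begin

text \<open>Injectivity of \<open>msubst s\<close> keeps nonzero denominators nonzero, so the
  substitution extends to an injective homomorphism of the fraction field.\<close>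

abbreviation "frac_subst \<equiv> ratfun_subst (\<lambda>i. of_mpoly (s i))"

lemma msubst_eq_0_iff: "msubst s p = 0 \<longleftrightarrow> p = 0"
  using inj_eq[OF inj, of p 0] by simp

lemma frac_subst_quot:
  "d \<noteq> 0 \<Longrightarrow> frac_subst (of_mpoly n / of_mpoly d) = of_mpoly (msubst s n) / of_mpoly (msubst s d)"
  by (rule ratfun_subst_quot) (simp add: msubst_eq_0_iff)

lemma frac_subst_add: "frac_subst (x + y) = frac_subst x + frac_subst y"
proof -
  obtain n d where x: "d \<noteq> 0" "x = of_mpoly n / of_mpoly d" by (rule ratfun_cases)
  obtain m e where y: "e \<noteq> 0" "y = of_mpoly m / of_mpoly e" by (rule ratfun_cases)
  have xy: "x + y = of_mpoly (n * e + m * d) / of_mpoly (d * e)"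
    using x y by (simp add: of_mpoly_add of_mpoly_mult add_frac_eq of_mpoly_eq_0_iff)
  show ?thesis
    unfolding xy using x y
    by (subst frac_subst_quot) (simp_all add: frac_subst_quot msubst_add msubst_mult
        of_mpoly_add of_mpoly_mult add_frac_eq of_mpoly_eq_0_iff msubst_eq_0_iff)
qed

lemma frac_subst_of_mpoly: "frac_subst (of_mpoly p) = of_mpoly (msubst s p)"
  using frac_subst_quot[of 1 p] by simp

lemma frac_subst_sum: "frac_subst (sum f F) = (\<Sum>i\<in>F. frac_subst (f i))"
  using frac_subst_of_mpoly[of 0]
  by (induction F rule: infinite_finite_induct) (simp_all add: frac_subst_add)

lemma frac_subst_inject: "frac_subst x = frac_subst y \<longleftrightarrow> x = y"
proof
  assume eq: "frac_subst x = frac_subst y"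
  obtain n d where x: "d \<noteq> 0" "x = of_mpoly n / of_mpoly d" by (rule ratfun_cases)
  obtain m e where y: "e \<noteq> 0" "y = of_mpoly m / of_mpoly e" by (rule ratfun_cases)
  have "of_mpoly (msubst s (n * e)) = of_mpoly (msubst s (m * d))"
    using eq x y
    by (simp add: frac_subst_quot frac_eq_eq of_mpoly_eq_0_iff msubst_eq_0_iff of_mpoly_mult
        msubst_mult del: of_mpoly_eq_iff)
  then have "n * e = m * d" using inj by (simp add: inj_eq)
  then show "x = y"
    using x y by (simp add: frac_eq_eq of_mpoly_eq_0_iff flip: of_mpoly_mult)
qed simp

lemma frac_subst_cyc_frac:
  assumes "distinct xs" "length xs \<ge> 2"
  shows "frac_subst (cyc_frac p xs) = cyc_frac p (map (msubst s) xs)"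
proof -
  have ne: "xs \<noteq> []" using assms by auto
  have "prod_list (steps xs) * (last xs - hd xs) \<noteq> 0"
    using assms zero_notin_steps[of xs] distinct_last_neq_hd[of xs] by (simp add: prod_list_0_iff)
  then show ?thesis
    unfolding cyc_frac_def
    by (subst frac_subst_quot) (simp_all add: msubst_list_subst msubst_mult msubst_prod_list
        msubst_diff map_steps last_map hd_map ne)
qed

lemma frac_subst_cyc_sum:
  assumes "distinct (0 # xs)"
  shows "frac_subst (cyc_sum p xs) = cyc_sum p (map (msubst s) xs)"
  unfolding cyc_sum_def frac_subst_sum length_map
proof (rule sum.cong)
  fix k assume "k \<in> {..<length xs}"
  then have "length (0 # rotate k xs) \<ge> 2" by auto
  then show "frac_subst (cyc_frac p (0 # rotate k xs)) =
      cyc_frac p (0 # rotate k (map (msubst s) xs))"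
    using assms by (subst frac_subst_cyc_frac) (simp_all add: rotate_map)
qed simp

end

text \<open>The substitution \<open>to_psums\<close> carries the reversed variables to the partial
  sums, fixes constants and is injective on rational functions.\<close>

lemma cyc_sum_const_iff:
  "cyc_sum p (psums r) = rat_const c \<longleftrightarrow> cyc_sum p (rev (mvars r)) = rat_const c"
proof -
  have inj: "inj (msubst (to_psums r))"
    by (metis injI msubst_from_to_psums)
  let ?\<Phi> = "ratfun_subst (\<lambda>i. of_mpoly (to_psums r i))"
  have "cyc_sum p (psums r) = ?\<Phi> (cyc_sum p (rev (mvars r)))"
    using frac_subst_cyc_sum[OF inj, of "rev (mvars r)"] distinct_mvars[of r]
    by (simp add: map_to_psums)
  moreover have "rat_const c = ?\<Phi> (rat_const c)"
    by (simp add: rat_const_def frac_subst_of_mpoly[OF inj])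
  ultimately show ?thesis by (metis frac_subst_inject[OF inj])
qed

section \<open>Fay relations compared with circ-neutrality\<close>

lemma psum_diff_eq_sum: "r \<ge> 1 \<Longrightarrow> of_mpoly (psum r - psum 1) = (\<Sum>i = 2..r. var_u i)"
proof (induction r rule: dec_induct)
  case (step n)
  then show ?case
    by (simp add: psum_Suc of_mpoly_diff of_mpoly_add var_u_eq algebra_simps)
qed simp

lemma psum_neq:
  assumes "r \<ge> 2"
  shows "psum r \<noteq> psum 1"
proof -
  have "psums r ! (r - 1) \<noteq> psums r ! 0"
    using distinct_psums[of r] assms by (subst nth_eq_iff_index_eq) auto
  then show ?thesis using assms by (simp add: psums_def del: upt_Suc)
qed

text \<open>By \<open>fay_mprime\<close> both sides of the relation carry the factor u_2 + ... +
  u_r, nonzero for r \<ge> 2. Once it is cancelled, the change of variables applies.\<close>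

lemma fay_mprime_iff:
  assumes "A r = of_mpoly p" "p \<in> mpolys r" "push_poly r p" "r \<ge> 2"
  shows "fay (mprime A) r = rat_const k * (\<Sum>i = 2..r. var_u i) \<longleftrightarrow>
    cyc_sum p (rev (mvars r)) = rat_const k"
proof -
  have "of_mpoly (psum r - psum 1) \<noteq> 0"
    using psum_neq[OF assms(4)] by (simp add: of_mpoly_eq_0_iff)
  then show ?thesis
    using assms fay_mprime[of A r p] psum_diff_eq_sum[of r] cyc_sum_const_iff[of p r k]
    by (auto simp: mult.commute)
qed

lemma circ_sum_eq_0_iff:
  assumes "A r = of_mpoly p" "r \<ge> 2" "C r = rat_const c"
  shows "(\<Sum>k<r. mould_at (mould_swap (inv mDelta A) + C) (rotate k (map var_u [1..<r + 1]))) = 0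
    \<longleftrightarrow> cyc_sum p (rev (mvars r)) = rat_const (- (of_nat r * c))"
proof -
  have "of_nat r * rat_const c = rat_const (of_nat r * c)"
    by (induction r) (simp_all add: rat_const_def algebra_simps single_add of_mpoly_add)
  moreover have "rat_const (- x) = - rat_const x" for x
    by (simp add: rat_const_def single_uminus flip: of_mpoly_uminus)
  ultimately show ?thesis
    using circ_sum_mould_swap[of A r p C c] assms by (simp add: add_eq_0_iff2)
qed

text \<open>Both conditions say that each cyclic sum of depth r \<ge> 2 is constant: it equals k_r
  on the Fay side and - r c_r on the circ-neutral side, and r is invertible in the
  rationals.\<close>

lemma circ_neutral_iff_fay:
  assumes A: "\<And>r. A r = of_mpoly (P r)" "\<And>r. P r \<in> mpolys r"
    and push: "\<And>r. r \<ge> 1 \<Longrightarrow> push_poly r (P r)"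
  shows "(\<exists>C. constant_mould C \<and> circ_neutral (mould_swap (inv mDelta A) + C)) \<longleftrightarrow>
    (\<exists>k :: nat \<Rightarrow> rat. \<forall>r \<ge> 2. fay (mprime A) r = rat_const (k r) * (\<Sum>i = 2..r. var_u i))"
    (is "?L \<longleftrightarrow> ?R")
proof -
  have R: "?R \<longleftrightarrow> (\<exists>k :: nat \<Rightarrow> rat. \<forall>r \<ge> 2. cyc_sum (P r) (rev (mvars r)) = rat_const (k r))"
  proof -
    have "fay (mprime A) r = rat_const k * (\<Sum>i = 2..r. var_u i) \<longleftrightarrow>
        cyc_sum (P r) (rev (mvars r)) = rat_const k" if "r \<ge> 2" for r k
      using that by (intro fay_mprime_iff A push) auto
    then show ?thesis by metis
  qed
  show ?thesis
  proof
    assume ?L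
    then obtain C where C: "constant_mould C" "circ_neutral (mould_swap (inv mDelta A) + C)" by blast
    then obtain c where c: "\<And>r. C r = rat_const (c r)"
      unfolding constant_mould_def by metis
    have "cyc_sum (P r) (rev (mvars r)) = rat_const (- (of_nat r * c r))" if "r \<ge> 2" for r
      using circ_sum_eq_0_iff[of A r, OF A(1) that, of C "c r"] c C(2) that by (simp add: circ_neutral_def)
    then show ?R
      unfolding R by (intro exI[of _ "\<lambda>r. - (of_nat r * c r)"] allI impI)
  next
    assume ?R
    then obtain k :: "nat \<Rightarrow> rat"
      where k: "\<And>r. r \<ge> 2 \<Longrightarrow> cyc_sum (P r) (rev (mvars r)) = rat_const (k r)"
      unfolding R by blast
    \<comment> \<open>Solves - r c_r = k_r. Depths 0 and 1 are unconstrained, so the default of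
      division by zero at r = 0 is harmless.\<close>
    let ?C = "\<lambda>r. rat_const (- k r / of_nat r)"
    have "circ_neutral (mould_swap (inv mDelta A) + ?C)"
      unfolding circ_neutral_def
    proof (intro allI impI)
      fix r :: nat assume r: "r \<ge> 2"
      show "(\<Sum>k<r. mould_at (mould_swap (inv mDelta A) + ?C)
          (rotate k (map var_u [1..<r + 1]))) = 0"
        using circ_sum_eq_0_iff[of A r, OF A(1) r, of ?C "- k r / of_nat r"] k[OF r] r by simp
    qed
    moreover have "constant_mould ?C" by (auto simp: constant_mould_def)
    ultimately show ?L by blast
  qed
qed

section \<open>The free generators of the kernel\<close>

text \<open>The empty word and the words ending in b, indexed by the lengths of their runs of a; the
  same lists index the monomials in the c_i.\<close>

definition bword :: "nat list \<Rightarrow> letter list" where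
  "bword es = concat (map (\<lambda>e. replicate e LetterA @ [LetterB]) es)"

lemma bword_simps [simp]:
  "bword [] = []" "bword (e # es) = replicate e LetterA @ LetterB # bword es"
  by (simp_all add: bword_def)

lemma length_bword: "length (bword es) = sum_list (map Suc es)"
  by (induction es) simp_all

section \<open>Coefficients of the generators and of their monomials\<close>

lemma nc_mult_letter_left:
  "nc_mult (nc_letter x) g w = (if w \<noteq> [] \<and> hd w = x then g (tl w) else 0)"
proof (cases w)
  case (Cons y v)
  have "nc_mult (nc_letter x) g w = (\<Sum>i\<in>{1}. nc_letter x (take i w) * g (drop i w))"
    unfolding nc_mult_def
  proof (rule sum.mono_neutral_right)
    show "\<forall>i\<in>{..length w} - {1}. nc_letter x (take i w) * g (drop i w) = 0"
    proof
      fix i assume "i \<in> {..length w} - {1}"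
      then have "length (take i w) \<noteq> 1" by auto
      then have "take i w \<noteq> [x]" by (metis length_Cons list.size(3) One_nat_def)
      then show "nc_letter x (take i w) * g (drop i w) = 0" by (simp add: nc_letter_def)
    qed
  qed (use Cons in auto)
  then show ?thesis by (simp add: Cons nc_letter_def)
qed (simp add: nc_mult_def nc_letter_def)

lemma nc_mult_letter_right:
  "nc_mult g (nc_letter x) w = (if w \<noteq> [] \<and> last w = x then g (butlast w) else 0)"
proof (cases w rule: rev_cases)
  case (snoc v y)
  have "nc_mult g (nc_letter x) w = (\<Sum>i\<in>{length v}. g (take i w) * nc_letter x (drop i w))"
    unfolding nc_mult_def
  proof (rule sum.mono_neutral_right)
    show "\<forall>i\<in>{..length w} - {length v}. g (take i w) * nc_letter x (drop i w) = 0"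
    proof
      fix i assume "i \<in> {..length w} - {length v}"
      then have "length (drop i w) \<noteq> 1" using snoc by auto
      then have "drop i w \<noteq> [x]" by (metis length_Cons list.size(3) One_nat_def)
      then show "g (take i w) * nc_letter x (drop i w) = 0" by (simp add: nc_letter_def)
    qed
  qed (use snoc in auto)
  then show ?thesis by (simp add: snoc nc_letter_def)
qed (simp add: nc_mult_def nc_letter_def)

lemma c_gen_0: "c_gen (Suc 0) = nc_letter LetterB"
  by (simp add: c_gen_def)

lemma c_gen_Suc: "c_gen (Suc (Suc e)) = nc_ad (nc_letter LetterA) (c_gen (Suc e))"
  by (simp add: c_gen_def)

text \<open>The bracket with a only attaches a letter a at the left or right end, so the single b of
  c_1 persists.\<close>

lemma c_gen_support:
  "c_gen (Suc e) w \<noteq> 0 \<Longrightarrow> \<exists>i \<le> e. w = replicate i LetterA @ LetterB # replicate (e - i) LetterA"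
proof (induction e arbitrary: w)
  case 0
  then show ?case by (simp add: c_gen_0 nc_letter_def split: if_splits)
next
  case (Suc e)
  consider "w \<noteq> []" "hd w = LetterA" "c_gen (Suc e) (tl w) \<noteq> 0"
    | "w \<noteq> []" "last w = LetterA" "c_gen (Suc e) (butlast w) \<noteq> 0"
    using Suc.prems
    by (fastforce simp: c_gen_Suc nc_ad_def nc_mult_letter_left nc_mult_letter_right
        split: if_splits)
  then show ?case
  proof cases
    case 1
    then obtain i where "i \<le> e" "tl w = replicate i LetterA @ LetterB # replicate (e - i) LetterA"
      using Suc.IH by blast
    then show ?thesis
      using 1 by (intro exI[of _ "Suc i"]) (metis Cons_replicate_eq append_Cons diff_Suc_Suc
          hd_Cons_tl not_less_eq_eq replicate_Suc)
  next
    case 2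
    then obtain i where i: "i \<le> e"
      "butlast w = replicate i LetterA @ LetterB # replicate (e - i) LetterA"
      using Suc.IH by blast
    then have "w = replicate i LetterA @ LetterB # replicate (e - i) LetterA @ [LetterA]"
      using 2 append_butlast_last_id[of w] by simp
    then show ?thesis
      using i by (intro exI[of _ i]) (simp add: Suc_diff_le replicate_append_same)
  qed
qed

text \<open>Right multiplication by a contributes nothing to a word ending in b, so only the left
  multiplications count.\<close>

lemma c_gen_leading: "c_gen (Suc e) (replicate e LetterA @ [LetterB]) = 1"
  by (induction e)
    (simp_all add: c_gen_0 nc_letter_def c_gen_Suc nc_ad_def nc_mult_letter_left
      nc_mult_letter_right)

lemma c_monomial_Nil [simp]: "c_monomial [] = nc_one"
  by (simp add: c_monomial_def)

lemma c_monomial_Cons: "c_monomial (e # es) = nc_mult (c_gen (Suc e)) (c_monomial es)"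
  by (simp add: c_monomial_def)

lemma c_monomial_Cons_nonzeroE:
  assumes "c_monomial (e # es) w \<noteq> 0"
  obtains i v where "i \<le> e" "w = replicate i LetterA @ LetterB # replicate (e - i) LetterA @ v"
    "c_monomial es v \<noteq> 0"
proof -
  obtain k where k: "c_gen (Suc e) (take k w) \<noteq> 0" "c_monomial es (drop k w) \<noteq> 0"
    using assms unfolding c_monomial_Cons nc_mult_def
    by (metis (no_types, lifting) mult_not_zero sum.neutral)
  then obtain i where "i \<le> e"
    "take k w = replicate i LetterA @ LetterB # replicate (e - i) LetterA"
    using c_gen_support by blast
  then show ?thesis
    using that[of i "drop k w"] k append_take_drop_id[of k w] by simp
qed

lemma replicate_A_B_eq:
  "replicate i LetterA @ LetterB # u = replicate j LetterA @ LetterB # v \<longleftrightarrow> i = j \<and> u = v"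
proof (induction i arbitrary: j)
  case 0
  show ?case by (cases j) auto
next
  case (Suc i)
  then show ?case by (cases j) auto
qed

text \<open>The first run of a in \<open>bword fs\<close> comes from the first generator, so its
  length is at most e. If it is shorter, \<open>fs\<close> is already lexicographically smaller; if
  it equals e, that generator uses up exactly the first block, and induction compares the
  rest.\<close>

lemma c_monomial_triangular: "c_monomial es (bword fs) \<noteq> 0 \<Longrightarrow> fs \<le> es"
proof (induction es arbitrary: fs)
  case Nil
  then show ?case by (cases fs) (auto simp: nc_one_def)
next
  case (Cons e es)
  then obtain i v where i: "i \<le> e"
    "bword fs = replicate i LetterA @ LetterB # replicate (e - i) LetterA @ v"
    "c_monomial es v \<noteq> 0"
    by (elim c_monomial_Cons_nonzeroE)
  show ?case
  proof (cases fs)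
    case Nil
    then show ?thesis by simp
  next
    case fs: (Cons f fs')
    then have "f = i" "bword fs' = replicate (e - i) LetterA @ v"
      using i(2) by (simp_all add: replicate_A_B_eq)
    then show ?thesis
      using i(1,3) Cons.IH[of fs'] fs by (cases "i = e") auto
  qed
qed

text \<open>As c_(e+1) is homogeneous of degree e + 1, only the cut after the first block of the
  word contributes to the product.\<close>

lemma c_monomial_leading: "c_monomial es (bword es) = 1"
proof (induction es)
  case Nil
  then show ?case by (simp add: nc_one_def)
next
  case (Cons e es)
  let ?w = "bword (e # es)"
  have "c_monomial (e # es) ?w =
      (\<Sum>i\<in>{Suc e}. c_gen (Suc e) (take i ?w) * c_monomial es (drop i ?w))"
    unfolding c_monomial_Cons nc_mult_def
  proof (rule sum.mono_neutral_right)
    show "\<forall>i\<in>{..length ?w} - {Suc e}. c_gen (Suc e) (take i ?w) * c_monomial es (drop i ?w) = 0"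
    proof
      fix i assume i: "i \<in> {..length ?w} - {Suc e}"
      then have "length (take i ?w) \<noteq> Suc e" by (simp only: length_take) auto
      then have "c_gen (Suc e) (take i ?w) = 0"
      proof (rule contrapos_np)
        assume "c_gen (Suc e) (take i ?w) \<noteq> 0"
        then obtain j where "j \<le> e"
          "take i ?w = replicate j LetterA @ LetterB # replicate (e - j) LetterA"
          using c_gen_support by blast
        then show "length (take i ?w) = Suc e" by (simp only: length_append) simp
      qed
      then show "c_gen (Suc e) (take i ?w) * c_monomial es (drop i ?w) = 0" by simp
    qed
  qed auto
  then show ?case using Cons.IH c_gen_leading[of e] by simp
qed

section \<open>Unitriangular systems indexed by compositions\<close>

definition compositions :: "nat \<Rightarrow> nat list set" where
  "compositions n = {es. sum_list (map Suc es) = n}"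

lemma finite_compositions: "finite (compositions n)"
proof (rule finite_subset)
  have "length es \<le> sum_list (map Suc es) \<and> set es \<subseteq> {..sum_list (map Suc es)}" for es
    by (induction es) auto
  then show "compositions n \<subseteq> {es. set es \<subseteq> {..n} \<and> length es \<le> n}"
    by (auto simp: compositions_def)
qed (simp add: finite_lists_length_le)

text \<open>Back substitution, adding indices in decreasing order: the column of the new least index
  b vanishes in the earlier rows, so the old solution stays valid, and the diagonal entry 1 solves
  the row of b.\<close>

lemma unitriangular_solve:
  fixes T :: "'a::linorder \<Rightarrow> 'a \<Rightarrow> 'b::comm_ring_1"
  assumes "finite S" "\<And>s. T s s = 1" "\<And>s t. T s t \<noteq> 0 \<Longrightarrow> s \<le> t"
  shows "\<exists>x. \<forall>s\<in>S. (\<Sum>t\<in>S. x t * T s t) = g s"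
  using assms(1)
proof (induction rule: finite_linorder_min_induct)
  case (insert b S)
  then obtain x where x: "\<forall>s\<in>S. (\<Sum>t\<in>S. x t * T s t) = g s" by blast
  define y where "y = x(b := g b - (\<Sum>t\<in>S. x t * T b t))"
  have b: "b \<notin> S" using insert by auto
  have eq: "(\<Sum>t\<in>S. y t * T s t) = (\<Sum>t\<in>S. x t * T s t)" for s
    using b by (intro sum.cong) (auto simp: y_def)
  have "T s b = 0" if "s \<in> S" for s
    using that insert assms(3)[of s b] by force
  then have "\<forall>s\<in>insert b S. (\<Sum>t\<in>insert b S. y t * T s t) = g s"
    using x b insert(1) assms(2) by (simp add: eq) (simp add: y_def)
  then show ?case by blast
qed simp

lemma unitriangular_unique:
  fixes T :: "'a::linorder \<Rightarrow> 'a \<Rightarrow> 'b::comm_ring_1"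
  assumes "finite S" "\<And>s. T s s = 1" "\<And>s t. T s t \<noteq> 0 \<Longrightarrow> s \<le> t"
    and "\<And>s. s \<in> S \<Longrightarrow> (\<Sum>t\<in>S. x t * T s t) = 0"
  shows "\<forall>s\<in>S. x s = 0"
  using assms(1,4)
proof (induction rule: finite_linorder_min_induct)
  case (insert b S)
  have b: "b \<notin> S" using insert by auto
  have "(\<Sum>t\<in>S. x t * T s t) = 0" if "s \<in> S" for s
  proof -
    have "T s b = 0" using that insert assms(3)[of s b] by force
    then show ?thesis using insert.prems[of s] that b insert(1) by simp
  qed
  then have "\<forall>s\<in>S. x s = 0" using insert.IH by blast
  then show ?case using insert.prems[of b] b insert(1) assms(2) by simp
qed simp

lemma c_series_eq: "c_series \<gamma> w = (\<Sum>es\<in>compositions (length w). \<gamma> es * c_monomial es w)"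
  by (simp add: c_series_def compositions_def)

lemma bword_compositions: "es \<in> compositions n \<Longrightarrow> length (bword es) = n"
  by (simp add: compositions_def length_bword)

lemma c_series_diff: "c_series (\<lambda>es. \<gamma> es - \<delta> es) w = c_series \<gamma> w - c_series \<delta> w"
  by (simp add: c_series_eq sum_subtractf left_diff_distrib)

text \<open>In each degree the coefficients of the monomials at the words \<open>bword\<close> form
  a finite unitriangular matrix.\<close>

lemma c_series_bword_eq_0D:
  assumes "\<And>fs. c_series \<gamma> (bword fs) = 0"
  shows "\<gamma> es = 0"
proof -
  have "\<forall>s\<in>compositions (length (bword es)). \<gamma> s = 0"
    by (rule unitriangular_unique[where T="\<lambda>s t. c_monomial t (bword s)"])
      (use assms in \<open>simp_all add: finite_compositions c_monomial_leading c_monomial_triangular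
        c_series_eq bword_compositions\<close>, metis bword_compositions)
  then show ?thesis by (simp add: compositions_def length_bword)
qed

lemma inj_c_series: "inj c_series"
proof (rule injI)
  fix \<gamma> \<delta> assume "c_series \<gamma> = c_series \<delta>"
  then have "c_series (\<lambda>es. \<gamma> es - \<delta> es) w = 0" for w by (simp add: c_series_diff)
  then have "\<gamma> es - \<delta> es = 0" for es by (rule c_series_bword_eq_0D)
  then show "\<gamma> = \<delta>" by auto
qed

lemma c_series_bword_solve: "\<exists>\<gamma>. \<forall>fs. c_series \<gamma> (bword fs) = f (bword fs)"
proof -
  have "\<exists>x. \<forall>s\<in>compositions n. (\<Sum>t\<in>compositions n. x t * c_monomial t (bword s)) = f (bword s)" for n
    by (rule unitriangular_solve)
      (simp_all add: finite_compositions c_monomial_leading c_monomial_triangular)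
  then obtain x where x: "\<And>n s. s \<in> compositions n \<Longrightarrow>
      (\<Sum>t\<in>compositions n. x n t * c_monomial t (bword s)) = f (bword s)"
    by metis
  \<comment> \<open>\<open>x n\<close> solves the system of degree n; each exponent list has a
    single degree, so these solutions glue to one family.\<close>
  define \<gamma> where "\<gamma> es = x (sum_list (map Suc es)) es" for es
  have "c_series \<gamma> (bword fs) = f (bword fs)" for fs
  proof -
    let ?n = "sum_list (map Suc fs)"
    have "c_series \<gamma> (bword fs) = (\<Sum>t\<in>compositions ?n. x ?n t * c_monomial t (bword fs))"
      unfolding c_series_eq length_bword by (intro sum.cong) (auto simp: \<gamma>_def compositions_def)
    also have "\<dots> = f (bword fs)" by (rule x) (simp add: compositions_def)
    finally show ?thesis .
  qed
  then show ?thesis by blast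
qed

subsection \<open>The derivation\<close>

definition ins_A :: "nat \<Rightarrow> letter list \<Rightarrow> letter list" where
  "ins_A i w = take i w @ LetterA # drop i w"

lemma nc_deriv_ins_A: "nc_deriv f w = (\<Sum>i\<le>length w. f (ins_A i w))"
  by (simp add: nc_deriv_def ins_A_def)

lemma length_ins_A [simp]: "length (ins_A i w) = Suc (length w)"
  by (simp add: ins_A_def)

text \<open>Leibniz rule: when w with an inserted a is cut in two, the new letter lies in exactly
  one of the factors.\<close>

lemma nc_deriv_mult:
  "nc_deriv (nc_mult f g) w = nc_mult (nc_deriv f) g w + nc_mult f (nc_deriv g) w"
proof -
  let ?n = "length w"
  have split: "nc_mult f g (ins_A i w) =
      (\<Sum>j\<in>{..i}. f (take j w) * g (ins_A (i - j) (drop j w))) +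
      (\<Sum>j\<in>{i..?n}. f (ins_A i (take j w)) * g (drop j w))" if i: "i \<le> ?n" for i
  proof -
    let ?h = "\<lambda>j. f (take j (ins_A i w)) * g (drop j (ins_A i w))"
    \<comment> \<open>Cuts at j \<le> i leave the inserted letter in the right factor, later cuts
      put it into the left one.\<close>
    have "nc_mult f g (ins_A i w) = sum ?h ({..i} \<union> {Suc i..Suc ?n})"
      unfolding nc_mult_def length_ins_A using i by (intro sum.cong) auto
    also have "\<dots> = sum ?h {..i} + sum ?h {Suc i..Suc ?n}"
      by (rule sum.union_disjoint) auto
    also have "sum ?h {Suc i..Suc ?n} = (\<Sum>j\<in>{i..?n}. ?h (Suc j))"
      by (rule sum.shift_bounds_cl_Suc_ivl)
    also have "\<dots> = (\<Sum>j\<in>{i..?n}. f (ins_A i (take j w)) * g (drop j w))"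
      using i by (intro sum.cong) (auto simp: ins_A_def Suc_diff_le min_def drop_take add.commute)
    also have "sum ?h {..i} = (\<Sum>j\<in>{..i}. f (take j w) * g (ins_A (i - j) (drop j w)))"
      using i by (intro sum.cong) (auto simp: ins_A_def min_def drop_take)
    finally show ?thesis .
  qed
  have "nc_deriv (nc_mult f g) w =
      (\<Sum>i\<le>?n. \<Sum>j\<in>{..i}. f (take j w) * g (ins_A (i - j) (drop j w))) +
      (\<Sum>i\<le>?n. \<Sum>j\<in>{i..?n}. f (ins_A i (take j w)) * g (drop j w))"
    by (simp add: nc_deriv_ins_A split sum.distrib)
  also have "(\<Sum>i\<le>?n. \<Sum>j\<in>{i..?n}. f (ins_A i (take j w)) * g (drop j w)) =
      (\<Sum>j\<le>?n. \<Sum>i\<le>j. f (ins_A i (take j w)) * g (drop j w))"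
    unfolding sum.Sigma[OF finite_atMost ballI, OF finite_atLeastAtMost]
      sum.Sigma[OF finite_atMost ballI, OF finite_atMost]
    by (rule sum.reindex_bij_witness[where i="\<lambda>(j, i). (i, j)" and j="\<lambda>(j, i). (i, j)"]) auto
  also have "\<dots> = nc_mult (nc_deriv f) g w"
    unfolding nc_mult_def nc_deriv_ins_A by (simp add: sum_distrib_right min_absorb2)
  \<comment> \<open>Reindexing by the cut j and by the position i - j of the insertion within the
    right factor.\<close>
  also have "(\<Sum>i\<le>?n. \<Sum>j\<in>{..i}. f (take j w) * g (ins_A (i - j) (drop j w))) =
      (\<Sum>j\<le>?n. \<Sum>i\<le>?n - j. f (take j w) * g (ins_A i (drop j w)))"
    unfolding sum.Sigma[OF finite_atMost ballI, OF finite_atMost]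
    by (rule sum.reindex_bij_witness[where i="\<lambda>(j, i). (i + j, j)" and j="\<lambda>(i, j). (j, i - j)"]) auto
  also have "\<dots> = nc_mult f (nc_deriv g) w"
    unfolding nc_mult_def nc_deriv_ins_A by (simp add: sum_distrib_left)
  finally show ?thesis by simp
qed

lemma nc_deriv_diff: "nc_deriv (f - g) w = nc_deriv f w - nc_deriv g w"
  by (simp add: nc_deriv_def sum_subtractf)

lemma nc_mult_0 [simp]: "nc_mult 0 g = 0" "nc_mult f 0 = 0"
  by (auto simp: nc_mult_def fun_eq_iff)

lemma nc_mult_one [simp]: "nc_mult nc_one g = g" "nc_mult g nc_one = g"
proof -
  have "nc_mult nc_one g w = (\<Sum>i\<in>{0}. nc_one (take i w) * g (drop i w))" for w
    unfolding nc_mult_def by (rule sum.mono_neutral_right) (auto simp: nc_one_def)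
  then show "nc_mult nc_one g = g" by (auto simp: nc_one_def)
  have "nc_mult g nc_one w = (\<Sum>i\<in>{length w}. g (take i w) * nc_one (drop i w))" for w
    unfolding nc_mult_def by (rule sum.mono_neutral_right) (auto simp: nc_one_def)
  then show "nc_mult g nc_one = g" by (auto simp: nc_one_def)
qed

lemma nc_deriv_one: "nc_deriv nc_one = 0"
  by (auto simp: fun_eq_iff nc_deriv_def nc_one_def)

lemma nc_deriv_letter:
  "nc_deriv (nc_letter LetterA) = nc_one" "nc_deriv (nc_letter LetterB) = 0"
proof -
  have "nc_deriv (nc_letter LetterA) w = nc_one w" for w
    by (cases w) (auto simp: nc_deriv_def nc_letter_def nc_one_def append_eq_Cons_conv intro!: sum.neutral)
  then show "nc_deriv (nc_letter LetterA) = nc_one" by auto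
  show "nc_deriv (nc_letter LetterB) = 0"
    by (auto simp: fun_eq_iff nc_deriv_def nc_letter_def append_eq_Cons_conv)
qed

lemma nc_deriv_mult_fun: "nc_deriv (nc_mult f g) = nc_mult (nc_deriv f) g + nc_mult f (nc_deriv g)"
  by (simp add: fun_eq_iff nc_deriv_mult)

lemma nc_deriv_diff_fun: "nc_deriv (f - g) = nc_deriv f - nc_deriv g"
  by (simp add: fun_eq_iff nc_deriv_diff)

text \<open>The derivation D sends [a, c] to [1, c] + [a, D c]; the first bracket is 0, and the
  second vanishes by induction.\<close>

lemma nc_deriv_c_gen: "nc_deriv (c_gen (Suc e)) = 0"
proof (induction e)
  case 0
  then show ?case by (simp only: c_gen_0 nc_deriv_letter)
next
  case (Suc e)
  then show ?case
    unfolding c_gen_Suc nc_ad_def nc_deriv_diff_fun nc_deriv_mult_fun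
    by (simp only: nc_deriv_letter nc_mult_0 nc_mult_one) simp
qed

lemma nc_deriv_c_monomial: "nc_deriv (c_monomial es) = 0"
proof (induction es)
  case Nil
  then show ?case by (simp only: c_monomial_Nil nc_deriv_one)
next
  case (Cons e es)
  then show ?case
    by (simp only: c_monomial_Cons nc_deriv_mult_fun nc_deriv_c_gen nc_mult_0 add_0_left)
qed

text \<open>Every insertion raises the length by exactly one, so a single finite set of monomials
  serves all insertions and the sums can be exchanged.\<close>

lemma c_series_in_kernel: "c_series \<gamma> \<in> nc_kernel"
proof -
  have "nc_deriv (c_series \<gamma>) w = (\<Sum>es\<in>compositions (Suc (length w)). \<gamma> es * nc_deriv (c_monomial es) w)" for w
    unfolding nc_deriv_ins_A c_series_eq length_ins_A
    by (subst sum.swap) (simp add: sum_distrib_left)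
  then show ?thesis by (simp add: nc_kernel_def nc_deriv_c_monomial fun_eq_iff)
qed

lemma letter_list_cases: "\<exists>fs n. w = bword fs @ replicate n LetterA"
proof (induction w)
  case Nil
  then show ?case by (intro exI[of _ "[]"] exI[of _ 0]) simp
next
  case (Cons x w)
  then obtain fs n where w: "w = bword fs @ replicate n LetterA" by blast
  show ?case
  proof (cases x)
    case LetterA
    show ?thesis
    proof (cases fs)
      case Nil
      then show ?thesis using w LetterA by (intro exI[of _ "[]"] exI[of _ "Suc n"]) simp
    next
      case (Cons f fs')
      then show ?thesis
        using w LetterA by (intro exI[of _ "Suc f # fs'"] exI[of _ n]) simp
    qed
  next
    case LetterB
    then show ?thesis using w by (intro exI[of _ "0 # fs"] exI[of _ n]) simp
  qed
qed

lemma last_bword: "es \<noteq> [] \<Longrightarrow> last (bword es) = LetterB"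
  by (induction es rule: rev_induct) (auto simp: bword_def)

text \<open>Induction on the number n of trailing letters a. In the vanishing derivative at
  \<open>bword fs\<close> followed by n letters a, an insertion inside \<open>bword fs\<close> keeps
  n trailing letters and contributes 0, while the n + 1 later positions all give the same word. So n
  + 1 times its coefficient is 0.\<close>

lemma nc_kernel_eq_0:
  assumes f: "f \<in> nc_kernel" and b: "\<And>fs. f (bword fs) = 0"
  shows "f w = 0"
proof -
  have "f (bword fs @ replicate n LetterA) = 0" for fs n
  proof (induction n arbitrary: fs)
    case 0
    then show ?case using b by simp
  next
    case (Suc n)
    let ?v = "bword fs" and ?w = "bword fs @ replicate n LetterA"
    have small: "f (ins_A i ?w) = 0" if i: "i < length ?v" for i
    proof -
      obtain gs m where gs: "ins_A i ?v = bword gs @ replicate m LetterA"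
        using letter_list_cases by blast
      have "fs \<noteq> []" using i by auto
      have "last (ins_A i ?v) = LetterB"
        using i last_bword[OF \<open>fs \<noteq> []\<close>] by (simp add: ins_A_def last_append)
      then have "m = 0" using gs by (cases m) (auto simp: replicate_append_same[symmetric] simp del: replicate.simps)
      then have "ins_A i ?w = bword gs @ replicate n LetterA"
        using gs i by (simp add: ins_A_def)
      then show ?thesis using Suc.IH by simp
    qed
    have big: "ins_A i ?w = bword fs @ replicate (Suc n) LetterA"
      if "length ?v \<le> i" "i \<le> length ?w" for i
    proof -
      have "take (i - length ?v) (replicate n LetterA) @ LetterA # drop (i - length ?v) (replicate n LetterA)
          = replicate (Suc n) LetterA"
        using that by (auto simp: min_def replicate_app_Cons_same simp flip: replicate_add)
      then show ?thesis using that by (simp add: ins_A_def)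
    qed
    have "0 = (\<Sum>i\<le>length ?w. f (ins_A i ?w))"
      using f unfolding nc_deriv_ins_A[symmetric] by (simp add: nc_kernel_def)
    also have "\<dots> = (\<Sum>i\<in>{length ?v..length ?w}. f (ins_A i ?w))"
      using small by (intro sum.mono_neutral_right) auto
    also have "\<dots> = (\<Sum>i\<in>{length ?v..length ?w}. f (bword fs @ replicate (Suc n) LetterA))"
      using big by (intro sum.cong) auto
    finally show ?case by simp
  qed
  then show ?thesis using letter_list_cases[of w] by auto
qed

text \<open>A series that agrees with f on the words \<open>bword\<close> differs from f by a kernel
  element vanishing on them, which is 0.\<close>

lemma range_c_series: "range c_series = nc_kernel"
proof
  show "range c_series \<subseteq> nc_kernel" using c_series_in_kernel by blast
  show "nc_kernel \<subseteq> range c_series"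
  proof
    fix f assume f: "f \<in> nc_kernel"
    obtain \<gamma> where \<gamma>: "\<And>fs. c_series \<gamma> (bword fs) = f (bword fs)"
      using c_series_bword_solve[of f] by blast
    have "c_series \<gamma> - f \<in> nc_kernel"
      using f c_series_in_kernel[of \<gamma>] by (simp add: nc_kernel_def nc_deriv_diff_fun)
    then have "(c_series \<gamma> - f) w = 0" for w
      by (rule nc_kernel_eq_0) (simp add: \<gamma>)
    then have "c_series \<gamma> = f" by (auto simp: fun_eq_iff)
    then show "f \<in> range c_series" by blast
  qed
qed

section \<open>The isomorphism\<close>

lemma mpolysD: "p \<in> mpolys r \<Longrightarrow> m \<in> Poly_Mapping.keys p \<Longrightarrow> Poly_Mapping.keys m \<subseteq> {1..r}"
  by (simp add: mpolys_def)

lemma mpolys_add: "p \<in> mpolys r \<Longrightarrow> q \<in> mpolys r \<Longrightarrow> p + q \<in> mpolys r"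
  using Poly_Mapping.keys_add[of p q] unfolding mpolys_def by blast

lemma lookup_mconst_mult: "Poly_Mapping.lookup (mconst c * p) m = c * Poly_Mapping.lookup p m"
  by (induction p rule: poly_mapping_single_induct)
    (simp_all add: mult_single lookup_single when_def distrib_left lookup_add)

lemma mpolys_mconst_mult: "p \<in> mpolys r \<Longrightarrow> mconst c * p \<in> mpolys r"
  by (auto simp: mpolys_def in_keys_iff lookup_mconst_mult simp del: subset_eq)

lemma ARI_pol_iff:
  "A \<in> ARI_pol \<longleftrightarrow> (\<exists>P. A = (\<lambda>r. of_mpoly (P r)) \<and> (\<forall>r. P r \<in> mpolys r) \<and> P 0 = 0)"
proof
  assume A: "A \<in> ARI_pol"
  then have "\<forall>r. \<exists>p. p \<in> mpolys r \<and> A r = of_mpoly p" by (auto simp: ARI_pol_def)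
  then obtain P where P: "\<And>r. P r \<in> mpolys r" "\<And>r. A r = of_mpoly (P r)" by metis
  moreover have "P 0 = 0"
    using A P(2)[of 0] by (simp add: ARI_pol_def ARI_def of_mpoly_eq_0_iff)
  ultimately show "\<exists>P. A = (\<lambda>r. of_mpoly (P r)) \<and> (\<forall>r. P r \<in> mpolys r) \<and> P 0 = 0" by blast
next
  assume "\<exists>P. A = (\<lambda>r. of_mpoly (P r)) \<and> (\<forall>r. P r \<in> mpolys r) \<and> P 0 = 0"
  then obtain P where P: "A = (\<lambda>r. of_mpoly (P r))" "\<And>r. P r \<in> mpolys r" "P 0 = 0" by blast
  have "1 \<in> mpolys r" for r by (simp add: mpolys_def)
  then have "of_mpoly (P r) \<in> ratfuns r" for r
    unfolding ratfuns_def of_mpoly_def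
    by (intro CollectI exI[of _ "P r"] exI[of _ 1]) (simp add: P(2))
  then show "A \<in> ARI_pol" using P by (auto simp: ARI_pol_def ARI_def moulds_def)
qed

section \<open>Alternality and push-invariance on both sides of Delta\<close>

lemma alternal_iff:
  "alternal (\<lambda>r. of_mpoly (P r)) \<longleftrightarrow>
    (\<forall>r \<ge> 2. \<forall>i \<in> {1..r - 1}.
      (\<Sum>w\<in>shuffles [1..<i + 1] [i + 1..<r + 1]. list_subst (map mvar w) (P r)) = 0)"
proof -
  have "(\<Sum>w\<in>shuffles [1..<i + 1] [i + 1..<r + 1].
        mould_at (\<lambda>r. of_mpoly (P r)) (map var_u w)) =
      of_mpoly (\<Sum>w\<in>shuffles [1..<i + 1] [i + 1..<r + 1]. list_subst (map mvar w) (P r))"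
    if "i \<in> {1..r - 1}" for r i
    unfolding of_mpoly_sum
  proof (rule sum.cong)
    fix w assume "w \<in> shuffles [1..<i + 1] [i + 1..<r + 1]"
    then have "length w = r" using length_shuffles that by fastforce
    then show "mould_at (\<lambda>r. of_mpoly (P r)) (map var_u w) =
        of_mpoly (list_subst (map mvar w) (P r))"
      unfolding map_var_u by (subst mould_at_of_mpoly) simp_all
  qed simp
  then show ?thesis unfolding alternal_def by (simp add: of_mpoly_eq_0_iff del: upt_Suc)
qed

lemma sum_list_mvars_neq_0: "r \<ge> 1 \<Longrightarrow> sum_list (mvars r) \<noteq> 0"
  using ubar_nonzero[of r] by (auto simp: ubar_eq)

text \<open>The factor of Delta is symmetric in the variables, so all shuffles share one nonzero
  denominator.\<close>

lemma alternal_inv_mDelta: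
  "alternal (inv mDelta (\<lambda>r. of_mpoly (P r))) \<longleftrightarrow> alternal (\<lambda>r. of_mpoly (P r))"
proof -
  let ?A = "\<lambda>r. of_mpoly (P r)"
  have "(\<Sum>w\<in>shuffles [1..<i + 1] [i + 1..<r + 1]. mould_at (inv mDelta ?A) (map var_u w)) =
      (\<Sum>w\<in>shuffles [1..<i + 1] [i + 1..<r + 1]. mould_at ?A (map var_u w)) /
      of_mpoly (prod_list (mvars r) * sum_list (mvars r))"
    if ri: "r \<ge> 2" "i \<in> {1..r - 1}" for r i
    unfolding sum_divide_distrib
  proof (rule sum.cong)
    fix w assume w: "w \<in> shuffles [1..<i + 1] [i + 1..<r + 1]"
    have "mset w = mset ([1..<i + 1] @ [i + 1..<r + 1])"
      using mset_shuffles[OF w] by simp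
    also have "[1..<i + 1] @ [i + 1..<r + 1] = [1..<r + 1]"
    proof -
      have "i + 1 + (r - i) = r + 1" using ri by auto
      then show ?thesis using upt_add_eq_append[of 1 "i + 1" "r - i"] by (simp only: le_add2)
    qed
    finally have "mset (map mvar w) = mset (mvars r)"
      by (simp only: mvars_def mset_map)
    then have eq: "length (map mvar w) = r" "prod_list (map mvar w) = prod_list (mvars r)"
      "sum_list (map mvar w) = sum_list (mvars r)"
      by (metis size_mset length_mvars, metis prod_mset_prod_list, metis sum_mset_sum_list)
    have "0 \<notin> set (map mvar w)" by auto
    then have "mould_at (inv mDelta ?A) (map of_mpoly (map mvar w)) =
        of_mpoly (list_subst (map mvar w) (P r)) /
        of_mpoly (prod_list (map mvar w) * sum_list (map mvar w))"
      using eq ri sum_list_mvars_neq_0[of r] by (intro mould_at_inv_mDelta) auto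
    moreover have "mould_at ?A (map of_mpoly (map mvar w)) = of_mpoly (list_subst (map mvar w) (P r))"
      using eq by (intro mould_at_of_mpoly) auto
    ultimately show "mould_at (inv mDelta ?A) (map var_u w) = mould_at ?A (map var_u w) /
        of_mpoly (prod_list (mvars r) * sum_list (mvars r))"
      unfolding map_var_u eq by simp
  qed simp
  moreover have "prod_list (mvars r) * sum_list (mvars r) \<noteq> 0" if "r \<ge> 2" for r
    using that sum_list_mvars_neq_0[of r] distinct_mvars[of r] by (simp add: prod_list_0_iff)
  ultimately show ?thesis
    unfolding alternal_def by (simp add: of_mpoly_eq_0_iff del: upt_Suc)
qed

lemma butlast_mvars: "butlast (mvars r) = map mvar [1..<r]"
  by (cases r) (simp_all add: mvars_Suc, simp add: mvars_def)

lemma push_args: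
  "- ubar r # map var_u [1..<r] = map of_mpoly (- sum_list (mvars r) # butlast (mvars r))"
  by (simp add: butlast_mvars map_var_u ubar_eq of_mpoly_uminus)

lemma push_invariant_iff:
  "push_invariant (\<lambda>r. of_mpoly (P r)) \<longleftrightarrow> (\<forall>r \<ge> 1. push_poly r (P r))"
proof -
  have "mould_at (\<lambda>r. of_mpoly (P r)) (- ubar r # map var_u [1..<r]) = of_mpoly (P r) \<longleftrightarrow>
      push_poly r (P r)" if "r \<ge> 1" for r
    unfolding push_args push_poly_def
    by (subst mould_at_of_mpoly[where n="P r"]) (use that in simp_all)
  then show ?thesis by (auto simp: push_invariant_def)
qed

lemma push_invariant_inv_mDelta:
  "push_invariant (inv mDelta (\<lambda>r. of_mpoly (P r))) \<longleftrightarrow> push_invariant (\<lambda>r. of_mpoly (P r))"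
proof -
  let ?A = "\<lambda>r. of_mpoly (P r)"
  have "mould_at (inv mDelta ?A) (- ubar r # map var_u [1..<r]) = inv mDelta ?A r \<longleftrightarrow>
      push_poly r (P r)" if r: "r \<ge> 1" for r
  proof -
    obtain n where n: "r = Suc n" using r by (cases r) auto
    let ?ys = "- sum_list (mvars r) # butlast (mvars r)"
    let ?D = "prod_list (mvars r) * sum_list (mvars r)"
    have ys: "length ?ys = r" "0 \<notin> set ?ys" "sum_list ?ys \<noteq> 0"
      using r sum_list_mvars_neq_0[of r] distinct_mvars[of r] by (auto simp: n mvars_Suc neg_eq_iff_add_eq_0)
    \<comment> \<open>The product now contains \<open>- sum_list (mvars r)\<close> in place of u_r,
      and the sum becomes - u_r: the two factors trade places and the signs cancel.\<close>
    have D: "prod_list ?ys * sum_list ?ys = ?D"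
      by (simp add: n mvars_Suc algebra_simps)
    have "?D \<noteq> 0"
      using r sum_list_mvars_neq_0[of r] distinct_mvars[of r] by (simp add: prod_list_0_iff)
    moreover have "inv mDelta ?A r = of_mpoly (P r) / of_mpoly ?D"
      using r by (simp add: inv_mDelta prod_var_u ubar_eq of_mpoly_mult del: One_nat_def)
    moreover have "mould_at (inv mDelta ?A) (map of_mpoly ?ys) =
        of_mpoly (list_subst ?ys (P r)) / of_mpoly ?D"
      using mould_at_inv_mDelta[of ?A ?ys "P r"] ys r D by simp
    ultimately show ?thesis
      unfolding push_args push_poly_def by (simp add: of_mpoly_eq_0_iff)
  qed
  then show ?thesis unfolding push_invariant_iff by (simp add: push_invariant_def)
qed

text \<open>Membership in \<open>fay_space\<close> in terms of the component polynomials. Constancy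
  of a cyclic sum replaces the Fay relation, so every clause is visibly linear in
  \<open>P\<close>.\<close>

definition fay_poly :: "(nat \<Rightarrow> mpoly) \<Rightarrow> bool" where
  "fay_poly P \<longleftrightarrow> P 0 = 0 \<and> (\<forall>r. P r \<in> mpolys r) \<and>
    (\<forall>r \<ge> 2. \<forall>i \<in> {1..r - 1}.
      (\<Sum>w\<in>shuffles [1..<i + 1] [i + 1..<r + 1]. list_subst (map mvar w) (P r)) = 0) \<and>
    (\<forall>r \<ge> 1. push_poly r (P r)) \<and>
    (\<forall>r \<ge> 2. \<exists>k. cyc_sum (P r) (rev (mvars r)) = rat_const k)"

lemma fay_poly_iff:
  assumes P: "\<And>r. P r \<in> mpolys r" "P 0 = 0"
  shows "(\<lambda>r. of_mpoly (P r)) \<in> fay_space \<longleftrightarrow> fay_poly P"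
proof -
  let ?A = "\<lambda>r. of_mpoly (P r)"
  have ARI: "?A \<in> ARI_pol" unfolding ARI_pol_iff using P by blast
  show ?thesis
  \<comment> \<open>The cyclic form of the Fay relation is available under push-invariance; if that
    fails, both sides are false.\<close>
  proof (cases "\<forall>r \<ge> 1. push_poly r (P r)")
    case True
    have "fay (mprime ?A) r = rat_const k * (\<Sum>i = 2..r. var_u i) \<longleftrightarrow>
        cyc_sum (P r) (rev (mvars r)) = rat_const k" if "r \<ge> 2" for r k
      by (rule fay_mprime_iff) (use P True that in auto)
    then have "(\<exists>k :: nat \<Rightarrow> rat. \<forall>r \<ge> 2. fay (mprime ?A) r = rat_const (k r) * (\<Sum>i = 2..r. var_u i)) \<longleftrightarrow>
        (\<forall>r \<ge> 2. \<exists>k. cyc_sum (P r) (rev (mvars r)) = rat_const k)"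
      by metis
    then show ?thesis
      unfolding fay_space_def fay_poly_def mem_Collect_eq alternal_iff push_invariant_iff
      by (simp only: ARI P True simp_thms)
  next
    case False
    then show ?thesis
      by (simp only: fay_space_def fay_poly_def mem_Collect_eq push_invariant_iff simp_thms)
  qed
qed

lemma fay_space_iff: "A \<in> fay_space \<longleftrightarrow> (\<exists>P. fay_poly P \<and> A = (\<lambda>r. of_mpoly (P r)))"
proof
  assume A: "A \<in> fay_space"
  then have "A \<in> ARI_pol" by (simp add: fay_space_def)
  then obtain P where P: "A = (\<lambda>r. of_mpoly (P r))" "\<And>r. P r \<in> mpolys r" "P 0 = 0"
    unfolding ARI_pol_iff by blast
  have "fay_poly P" using A unfolding P(1) fay_poly_iff[OF P(2,3)] .
  then show "\<exists>P. fay_poly P \<and> A = (\<lambda>r. of_mpoly (P r))" using P(1) by blast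
next
  assume "\<exists>P. fay_poly P \<and> A = (\<lambda>r. of_mpoly (P r))"
  then obtain P where P: "fay_poly P" "A = (\<lambda>r. of_mpoly (P r))" by blast
  have "\<And>r. P r \<in> mpolys r" "P 0 = 0" using P(1) by (simp_all add: fay_poly_def)
  then show "A \<in> fay_space" using P fay_poly_iff by blast
qed

text \<open>Passing from F to M preserves alternality and push-invariance, and
  \<open>circ_neutral_iff_fay\<close> converts the last condition; so F ranges over exactly
  \<open>fay_space\<close>.\<close>

lemma krv_ell_iff:
  "f \<in> krv_ell \<longleftrightarrow> f \<in> nc_kernel \<and> (\<exists>P. fay_poly P \<and> ma_is_mould f (\<lambda>r. of_mpoly (P r)))"
proof -
  have "alternal (inv mDelta F) \<and> push_invariant (inv mDelta F) \<and>
      (\<exists>C. constant_mould C \<and> circ_neutral (mould_swap (inv mDelta F) + C)) \<longleftrightarrow> F \<in> fay_space"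
    if F: "F \<in> ARI_pol" for F
  proof -
    obtain P where P: "F = (\<lambda>r. of_mpoly (P r))" "\<And>r. P r \<in> mpolys r"
      using F unfolding ARI_pol_iff by blast
    show ?thesis
      using F circ_neutral_iff_fay[of F P] P
      by (auto simp: fay_space_def alternal_inv_mDelta push_invariant_inv_mDelta push_invariant_iff)
  qed
  moreover have "fay_space \<subseteq> ARI_pol" by (auto simp: fay_space_def)
  ultimately have "f \<in> krv_ell \<longleftrightarrow> f \<in> nc_kernel \<and> (\<exists>F \<in> fay_space. ma_is_mould f F)"
    unfolding krv_ell_def Let_def by blast
  then show ?thesis unfolding Bex_def fay_space_iff by blast
qed

subsection \<open>Coefficients\<close>

text \<open>Inverse to reading off the exponents at 1, ..., r. The length is not recoverable from
  the result, since trailing zeros leave no trace in an exponent vector.\<close>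

definition exponents :: "nat list \<Rightarrow> nat \<Rightarrow>\<^sub>0 nat" where
  "exponents es = (\<Sum>i<length es. Poly_Mapping.single (Suc i) (es ! i))"

lemma lookup_exponents:
  "Poly_Mapping.lookup (exponents es) i = (if 1 \<le> i \<and> i \<le> length es then es ! (i - 1) else 0)"
  by (cases i) (auto simp: exponents_def lookup_sum lookup_single when_def)

lemma keys_exponents: "Poly_Mapping.keys (exponents es) \<subseteq> {1..length es}"
  by (auto simp: in_keys_iff lookup_exponents split: if_splits)

lemma map_lookup_exponents:
  "map (Poly_Mapping.lookup (exponents es)) [1..<length es + 1] = es"
  by (rule nth_equalityI) (auto simp: lookup_exponents simp del: upt_Suc)

lemma exponents_map_lookup:
  assumes "Poly_Mapping.keys m \<subseteq> {1..r}"
  shows "exponents (map (Poly_Mapping.lookup m) [1..<r + 1]) = m"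
proof (rule poly_mapping_eqI)
  fix i
  have "i \<notin> {1..r} \<Longrightarrow> Poly_Mapping.lookup m i = 0"
    using assms by (auto simp: in_keys_iff subset_eq)
  then show "Poly_Mapping.lookup (exponents (map (Poly_Mapping.lookup m) [1..<r + 1])) i =
      Poly_Mapping.lookup m i"
    by (cases "i \<in> {1..r}") (auto simp: lookup_exponents simp del: upt_Suc)
qed

text \<open>Packs all depths into one function: the length of \<open>es\<close> is the depth and its
  entries give the monomial, which is the indexing of \<open>c_series\<close>.\<close>

definition coeffs :: "(nat \<Rightarrow> mpoly) \<Rightarrow> nat list \<Rightarrow> rat" where
  "coeffs P es = Poly_Mapping.lookup (P (length es)) (exponents es)"

lemma ma_c_series:
  "ma (c_series \<gamma>) r m =
    (if Poly_Mapping.keys m \<subseteq> {1..r} then \<gamma> (map (Poly_Mapping.lookup m) [1..<r + 1]) else 0)"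
  by (simp add: ma_def inv_f_f[OF inj_c_series])

lemma lookup_coeffs:
  assumes "P r \<in> mpolys r"
  shows "Poly_Mapping.lookup (P r) m =
    (if Poly_Mapping.keys m \<subseteq> {1..r} then coeffs P (map (Poly_Mapping.lookup m) [1..<r + 1]) else 0)"
  using exponents_map_lookup[of m r] mpolysD[OF assms, of m]
  by (auto simp: coeffs_def in_keys_iff simp del: upt_Suc)

text \<open>A kernel element has exactly one coefficient family, and \<open>ma\<close> merely sorts
  that family by depth and exponent vector.\<close>

lemma ma_is_mould_iff:
  assumes "f \<in> nc_kernel" "\<And>r. P r \<in> mpolys r"
  shows "ma_is_mould f (\<lambda>r. of_mpoly (P r)) \<longleftrightarrow> f = c_series (coeffs P)"
proof -
  obtain \<gamma> where \<gamma>: "f = c_series \<gamma>" using assms(1) range_c_series by blast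
  have "ma_is_mould f (\<lambda>r. of_mpoly (P r)) \<longleftrightarrow> (\<forall>r. Poly_Mapping.lookup (P r) = ma f r)"
    by (auto simp: ma_is_mould_def)
  also have "\<dots> \<longleftrightarrow> \<gamma> = coeffs P"
  proof
    assume *: "\<forall>r. Poly_Mapping.lookup (P r) = ma f r"
    show "\<gamma> = coeffs P"
    proof
      fix es
      have "coeffs P es = ma f (length es) (exponents es)" by (simp add: coeffs_def *)
      then show "\<gamma> es = coeffs P es"
        by (simp add: \<gamma> ma_c_series keys_exponents map_lookup_exponents del: upt_Suc One_nat_def)
    qed
  next
    assume "\<gamma> = coeffs P"
    then show "\<forall>r. Poly_Mapping.lookup (P r) = ma f r"
      using assms(2) by (auto simp: fun_eq_iff \<gamma> ma_c_series lookup_coeffs simp del: upt_Suc)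
  qed
  also have "\<dots> \<longleftrightarrow> f = c_series (coeffs P)" by (simp add: \<gamma> inj_eq[OF inj_c_series])
  finally show ?thesis .
qed

lemma fay_polyD: "fay_poly P \<Longrightarrow> P r \<in> mpolys r"
  by (simp add: fay_poly_def)

lemma krv_ell_eq: "krv_ell = {c_series (coeffs P) | P. fay_poly P}"
proof -
  have "ma_is_mould f (\<lambda>r. of_mpoly (P r)) \<longleftrightarrow> f = c_series (coeffs P)"
    if "f \<in> nc_kernel" "fay_poly P" for f P
    using that fay_polyD by (intro ma_is_mould_iff) auto
  then show ?thesis
    using c_series_in_kernel unfolding set_eq_iff krv_ell_iff mem_Collect_eq by metis
qed

subsection \<open>Linearity\<close>

lemma push_poly_add: "push_poly r p \<Longrightarrow> push_poly r q \<Longrightarrow> push_poly r (p + q)"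
  by (simp add: push_poly_def list_subst_add)

lemma push_poly_scale: "push_poly r p \<Longrightarrow> push_poly r (mconst c * p)"
  by (simp add: push_poly_def list_subst_mult list_subst_const)

text \<open>The denominators depend on the points alone, and the numerators are linear in the
  polynomial.\<close>

lemma cyc_sum_add: "cyc_sum (p + q) xs = cyc_sum p xs + cyc_sum q xs"
  by (simp add: cyc_sum_def cyc_frac_def list_subst_add of_mpoly_add add_divide_distrib sum.distrib)

lemma cyc_sum_scale: "cyc_sum (mconst c * p) xs = rat_const c * cyc_sum p xs"
  by (simp add: cyc_sum_def cyc_frac_def list_subst_mult list_subst_const of_mpoly_mult rat_const_def
      sum_distrib_left)

lemma fay_poly_add: "fay_poly P \<Longrightarrow> fay_poly Q \<Longrightarrow> fay_poly (\<lambda>r. P r + Q r)"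
  unfolding fay_poly_def
  by (auto simp: mpolys_add list_subst_add sum.distrib push_poly_add cyc_sum_add simp del: upt_Suc)
    (metis of_mpoly_add rat_const_def single_add)

lemma fay_poly_scale: "fay_poly P \<Longrightarrow> fay_poly (\<lambda>r. mconst c * P r)"
  unfolding fay_poly_def
  by (auto simp: mpolys_mconst_mult list_subst_mult list_subst_const push_poly_scale cyc_sum_scale
      simp flip: sum_distrib_left simp del: upt_Suc)
    (metis mconst_mult of_mpoly_mult rat_const_def)

lemma coeffs_add: "coeffs (\<lambda>r. P r + Q r) = (\<lambda>es. coeffs P es + coeffs Q es)"
  by (simp add: coeffs_def fun_eq_iff lookup_add)

lemma coeffs_scale: "coeffs (\<lambda>r. mconst c * P r) = (\<lambda>es. c * coeffs P es)"
  by (simp add: coeffs_def fun_eq_iff lookup_mconst_mult)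

lemma c_series_add: "c_series (\<lambda>es. \<gamma> es + \<delta> es) = c_series \<gamma> + c_series \<delta>"
  by (simp add: fun_eq_iff c_series_eq sum.distrib distrib_right)

lemma c_series_scale: "c_series (\<lambda>es. c * \<gamma> es) = nc_scale c (c_series \<gamma>)"
  by (simp add: fun_eq_iff c_series_eq nc_scale_def sum_distrib_left mult.assoc)

lemma fay_poly_0: "fay_poly (\<lambda>r. 0)"
proof -
  have "list_subst ys 0 = 0" for ys using list_subst_const[of ys 0] by simp
  moreover have "rat_const 0 = 0" by (simp add: rat_const_def)
  ultimately show ?thesis
    by (auto simp: fay_poly_def mpolys_def push_poly_def cyc_sum_def cyc_frac_def intro!: exI[of _ 0])
qed

lemma subspace_fay_space: "module.subspace mould_scale fay_space"
proof -
  interpret vector_space mould_scale by (rule vector_space_mould)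
  show ?thesis
  proof (rule subspaceI)
    show "0 \<in> fay_space"
      unfolding fay_space_iff using fay_poly_0 by (intro exI[of _ "\<lambda>r. 0"]) (simp add: fun_eq_iff)
  next
    fix A B assume "A \<in> fay_space" "B \<in> fay_space"
    then obtain P Q where "fay_poly P" "fay_poly Q"
      "A = (\<lambda>r. of_mpoly (P r))" "B = (\<lambda>r. of_mpoly (Q r))"
      unfolding fay_space_iff by blast
    then show "A + B \<in> fay_space"
      unfolding fay_space_iff
      by (intro exI[of _ "\<lambda>r. P r + Q r"]) (simp add: fay_poly_add of_mpoly_add fun_eq_iff)
  next
    fix c A assume "A \<in> fay_space"
    then obtain P where "fay_poly P" "A = (\<lambda>r. of_mpoly (P r))"
      unfolding fay_space_iff by blast
    then show "mould_scale c A \<in> fay_space"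
      unfolding fay_space_iff
      by (intro exI[of _ "\<lambda>r. mconst c * P r"])
        (simp add: fay_poly_scale of_mpoly_mult mould_scale_def rat_const_def)
  qed
qed

lemma subspace_krv_ell: "module.subspace nc_scale krv_ell"
proof -
  interpret vector_space nc_scale by (rule vector_space_ncps)
  show ?thesis
  proof (rule subspaceI)
    have "c_series (coeffs (\<lambda>r. 0)) = 0"
      by (simp add: fun_eq_iff c_series_eq coeffs_def)
    then show "0 \<in> krv_ell"
      unfolding krv_ell_eq using fay_poly_0 by (metis (mono_tags, lifting) mem_Collect_eq)
  next
    fix f g assume "f \<in> krv_ell" "g \<in> krv_ell"
    then obtain P Q where "fay_poly P" "fay_poly Q"
      "f = c_series (coeffs P)" "g = c_series (coeffs Q)"
      unfolding krv_ell_eq by blast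
    then show "f + g \<in> krv_ell"
      unfolding krv_ell_eq using fay_poly_add
      by (auto simp flip: c_series_add coeffs_add)
  next
    fix c f assume "f \<in> krv_ell"
    then obtain P where "fay_poly P" "f = c_series (coeffs P)"
      unfolding krv_ell_eq by blast
    then show "nc_scale c f \<in> krv_ell"
      unfolding krv_ell_eq using fay_poly_scale
      by (auto simp flip: c_series_scale coeffs_scale)
  qed
qed

theorem theoremA:
  shows "isomorphic_subspaces mould_scale fay_space nc_scale krv_ell"
proof -
  \<comment> \<open>This inverts \<open>ma\<close>: as \<open>of_mpoly\<close> is injective,
    \<open>inv of_mpoly\<close> recovers the component polynomials.\<close>
  define \<phi> where "\<phi> A = c_series (coeffs (\<lambda>r. inv of_mpoly (A r)))" for A :: mould
  have \<phi>: "\<phi> (\<lambda>r. of_mpoly (P r)) = c_series (coeffs P)" for P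
    using inv_f_f[of of_mpoly] by (simp add: \<phi>_def inj_def)
  have "inj_on \<phi> fay_space"
  proof (rule inj_onI)
    fix A B assume "A \<in> fay_space" "B \<in> fay_space" "\<phi> A = \<phi> B"
    then obtain P Q where PQ: "fay_poly P" "fay_poly Q"
      "A = (\<lambda>r. of_mpoly (P r))" "B = (\<lambda>r. of_mpoly (Q r))"
      "coeffs P = coeffs Q"
      unfolding fay_space_iff by (auto simp: \<phi> inj_eq[OF inj_c_series])
    \<comment> \<open>The family of coefficients determines each component, because coefficients at
      exponent vectors supported outside 1..r are 0.\<close>
    then have "Poly_Mapping.lookup (P r) m = Poly_Mapping.lookup (Q r) m" for r m
      by (simp add: lookup_coeffs fay_polyD)
    then have "P r = Q r" for r by (simp add: poly_mapping_eqI)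
    then show "A = B" using PQ by simp
  qed
  moreover have "\<phi> ` fay_space = krv_ell"
  proof
    show "\<phi> ` fay_space \<subseteq> krv_ell"
      by (auto simp: krv_ell_eq fay_space_iff \<phi>) blast
    show "krv_ell \<subseteq> \<phi> ` fay_space"
    proof
      fix f assume "f \<in> krv_ell"
      then obtain P where P: "fay_poly P" "f = \<phi> (\<lambda>r. of_mpoly (P r))"
        unfolding krv_ell_eq \<phi> by blast
      have "(\<lambda>r. of_mpoly (P r)) \<in> fay_space"
        unfolding fay_space_iff by (intro exI[of _ P] conjI refl P(1))
      then show "f \<in> \<phi> ` fay_space"
        unfolding P(2) by (rule imageI)
    qed
  qed
  ultimately have bij: "bij_betw \<phi> fay_space krv_ell" by (simp add: bij_betw_def)
  have add: "\<phi> (A + B) = \<phi> A + \<phi> B" if AB: "A \<in> fay_space" "B \<in> fay_space" for A B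
  proof -
    obtain P Q where PQ: "A = (\<lambda>r. of_mpoly (P r))" "B = (\<lambda>r. of_mpoly (Q r))"
      using AB unfolding fay_space_iff by blast
    have "A + B = (\<lambda>r. of_mpoly (P r + Q r))" by (simp add: PQ of_mpoly_add fun_eq_iff)
    then show ?thesis using \<phi>[of "\<lambda>r. P r + Q r"] by (simp only: \<phi> PQ coeffs_add c_series_add)
  qed
  have scale: "\<phi> (mould_scale c A) = nc_scale c (\<phi> A)" if A: "A \<in> fay_space" for c A
  proof -
    obtain P where P: "A = (\<lambda>r. of_mpoly (P r))"
      using A unfolding fay_space_iff by blast
    have "mould_scale c A = (\<lambda>r. of_mpoly (mconst c * P r))"
      by (simp add: P mould_scale_def rat_const_def of_mpoly_mult)
    then show ?thesis using \<phi>[of "\<lambda>r. mconst c * P r"] by (simp only: \<phi> P coeffs_scale c_series_scale)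
  qed
  show ?thesis
    unfolding isomorphic_subspaces_def
    using vector_space_mould vector_space_ncps subspace_fay_space subspace_krv_ell bij add scale
    by blast
qed

end
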